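(* Let $(\tilde{\mathfrak{J}},\tilde\alpha,\tilde\omega)$ be a cosymplectic JJ-algebra such that $\tilde{\mathfrak{J}}\neq\{0\}$. Then $(\tilde{\mathfrak{J}},\tilde\alpha,\tilde\omega)$ is a double extension of a cosymplectic JJ-algebra $(\mathfrak{J},\alpha,\omega)$.
   Context: All algebras are finite-dimensional over a field $\mathbb{K}$ of characteristic different from $2$ and $3$. A JJ-algebra (Jacobi-Jordan algebra) is a vector space $\mathfrak{J}$ with a commutative bilinear product $\cdot$ satisfying $x\cdot(y\cdot z)+y\cdot(z\cdot x)+z\cdot(x\cdot y)=0$ for all $x,y,z$. A cosymplectic structure on a JJ-algebra $(\mathfrak{J},\cdot)$ of dimension $2n+1$ is a pair $(\alpha,\omega)$ with $\alpha$ a $1$-form (linear form) and $\omega$ a skew-symmetric bilinear form such that $\alpha\wedge\omega^n\neq0$ (where $\omega^n$ is the $n$-fold wedge power of $\omega$), $\alpha(x\cdot y)=0$, and $\omega(x\cdot y,z)+\omega(z\cdot x,y)+\omega(y\cdot z,x)=0$ for all $x,y,z\in\mathfrak{J}$; $(\mathfrak{J},\alpha,\omega)$ is then a cosymplectic JJ-algebra. Double extension of JJ-algebras: given a JJ-algebra $(\mathfrak{J},\cdot)$, a symmetric bilinear form $\theta$ on $\mathfrak{J}$, a linear map $\varphi:\mathfrak{J}\to\mathfrak{J}$, a linear form $\lambda$ on $\mathfrak{J}$ and $a\in\mathfrak{J}$, consider on $\langle d\rangle\oplus\mathfrak{J}\oplus\langle e\rangle$ the commutative product $\bullet$ given, for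 $x,y\in\mathfrak{J}$, by $$x\bullet y=x\cdot y+\theta(x,y)e,\quad d\bullet x=\varphi(x)+\lambda(x)e,\quad d\bullet d=a,$$ all products with $e$ being zero. When this is a JJ-algebra it is called a double extension of $(\mathfrak{J},\cdot)$ by $(\theta,\varphi,\lambda,a)$. A cosymplectic JJ-algebra $(\tilde{\mathfrak{J}},\tilde\alpha,\tilde\omega)$ is a double extension of a cosymplectic JJ-algebra $(\mathfrak{J},\alpha,\omega)$ if, up to isomorphism of JJ-algebras carrying the structures along, $\tilde{\mathfrak{J}}=\langle d\rangle\oplus\mathfrak{J}\oplus\langle e\rangle$ is a double extension of $(\mathfrak{J},\cdot)$ by some $(\theta,\varphi,\lambda,a)$, with $\tilde\omega(x,y)=\omega(x,y)$ and $\tilde\alpha(x)=\alpha(x)$ for $x,y\in\mathfrak{J}$, $\tilde\omega(d,e)=1$, $\tilde\omega(d,x)=\tilde\omega(e,x)=0$ for $x\in\mathfrak{J}$, and $\tilde\alpha(d),\tilde\alpha(e)\in\mathbb{K}$.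
   Formalization: The algebra is additionally assumed not to have dimension 1: the 1-dimensional algebra with zero product, α = id and ω = 0 is a nonzero cosymplectic JJ-algebra, but any double extension of a cosymplectic JJ-algebra has dimension at least 3. *)

theory Defs
  imports Complex_Main "HOL-Library.Product_Plus"
begin

text \<open>
  Algebras live on subspaces \<open>J\<close> of an ambient vector space given by
  \<open>scale\<close>; all maps are constrained on the carrier \<open>J\<close> only.
\<close>

definition linear_map_on ::
  "('k \<Rightarrow> 'v \<Rightarrow> 'v) \<Rightarrow> ('k \<Rightarrow> 'w \<Rightarrow> 'w) \<Rightarrow> 'v set \<Rightarrow> 'w set
    \<Rightarrow> ('v::ab_group_add \<Rightarrow> 'w::ab_group_add) \<Rightarrow> bool" where
  "linear_map_on s1 s2 V W f \<longleftrightarrow>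
     (\<forall>x\<in>V. f x \<in> W) \<and>
     (\<forall>x\<in>V. \<forall>y\<in>V. f (x + y) = f x + f y) \<and>
     (\<forall>c. \<forall>x\<in>V. f (s1 c x) = s2 c (f x))"

definition bilinear_map_on ::
  "('k \<Rightarrow> 'v \<Rightarrow> 'v) \<Rightarrow> ('k \<Rightarrow> 'w \<Rightarrow> 'w) \<Rightarrow> 'v set \<Rightarrow> 'w set
    \<Rightarrow> ('v::ab_group_add \<Rightarrow> 'v \<Rightarrow> 'w::ab_group_add) \<Rightarrow> bool" where
  "bilinear_map_on s1 s2 V W b \<longleftrightarrow>
     (\<forall>x\<in>V. linear_map_on s1 s2 V W (\<lambda>y. b x y)) \<and>
     (\<forall>y\<in>V. linear_map_on s1 s2 V W (\<lambda>x. b x y))"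

abbreviation linear_form_on ::
  "('k::field \<Rightarrow> 'v \<Rightarrow> 'v) \<Rightarrow> 'v set \<Rightarrow> ('v::ab_group_add \<Rightarrow> 'k) \<Rightarrow> bool" where
  "linear_form_on s V \<equiv> linear_map_on s (*) V UNIV"

abbreviation bilinear_form_on ::
  "('k::field \<Rightarrow> 'v \<Rightarrow> 'v) \<Rightarrow> 'v set \<Rightarrow> ('v::ab_group_add \<Rightarrow> 'v \<Rightarrow> 'k) \<Rightarrow> bool" where
  "bilinear_form_on s V \<equiv> bilinear_map_on s (*) V UNIV"

locale jj_algebra = vector_space scale
  for scale :: "'k::field \<Rightarrow> 'v::ab_group_add \<Rightarrow> 'v" +
  fixes J :: "'v set" and mult :: "'v \<Rightarrow> 'v \<Rightarrow> 'v"
  assumes finite_dim: "\<exists>B. finite B \<and> B \<subseteq> J \<and> span B = J"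
    and mult_bilinear: "bilinear_map_on scale scale J J mult"
    and mult_commute: "x \<in> J \<Longrightarrow> y \<in> J \<Longrightarrow> mult x y = mult y x"
    and jacobi: "x \<in> J \<Longrightarrow> y \<in> J \<Longrightarrow> z \<in> J \<Longrightarrow>
      mult x (mult y z) + mult y (mult z x) + mult z (mult x y) = 0"

text \<open>
  A \<open>p\<close>-form is evaluated on lists of \<open>p\<close> vectors. The wedge product of a
  \<open>p\<close>-form and a \<open>q\<close>-form is the sum over \<open>(p,q)\<close>-shuffles, without factorial
  denominators, so it makes sense in every characteristic. A shuffle is given
  by the set \<open>S\<close> of positions passed to the first factor; its sign is
  determined by the number of inversions between \<open>S\<close> and its complement.
\<close>

definition wedge ::
  "nat \<Rightarrow> nat \<Rightarrow> ('v list \<Rightarrow> 'k::comm_ring_1) \<Rightarrow> ('v list \<Rightarrow> 'k) \<Rightarrow> 'v list \<Rightarrow> 'k" where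
  "wedge p q \<eta> \<zeta> vs =
     (\<Sum>S | S \<subseteq> {..<p + q} \<and> card S = p.
        (- 1) ^ card {(i, j). i \<in> S \<and> j \<in> {..<p + q} - S \<and> j < i}
        * \<eta> (nths vs S) * \<zeta> (nths vs ({..<p + q} - S)))"

primrec wedge_power ::
  "nat \<Rightarrow> ('v list \<Rightarrow> 'k::comm_ring_1) \<Rightarrow> nat \<Rightarrow> 'v list \<Rightarrow> 'k" where
  "wedge_power p \<eta> 0 = (\<lambda>_. 1)"
| "wedge_power p \<eta> (Suc n) = wedge p (n * p) \<eta> (wedge_power p \<eta> n)"

definition one_form :: "('v \<Rightarrow> 'k) \<Rightarrow> 'v list \<Rightarrow> 'k" where
  "one_form \<alpha> vs = \<alpha> (vs ! 0)"

definition two_form :: "('v \<Rightarrow> 'v \<Rightarrow> 'k) \<Rightarrow> 'v list \<Rightarrow> 'k" where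
  "two_form \<omega> vs = \<omega> (vs ! 0) (vs ! 1)"

text \<open>\<open>nonzero_form_on k V \<eta>\<close>: the \<open>k\<close>-form \<open>\<eta>\<close> is not the zero form on \<open>V\<close>.\<close>

definition nonzero_form_on :: "nat \<Rightarrow> 'v set \<Rightarrow> ('v list \<Rightarrow> 'k::zero) \<Rightarrow> bool" where
  "nonzero_form_on k V \<eta> \<longleftrightarrow> (\<exists>vs. length vs = k \<and> set vs \<subseteq> V \<and> \<eta> vs \<noteq> 0)"

locale cosymplectic_jj_algebra = jj_algebra scale J mult
  for scale :: "'k::field \<Rightarrow> 'v::ab_group_add \<Rightarrow> 'v"
    and J :: "'v set" and mult :: "'v \<Rightarrow> 'v \<Rightarrow> 'v" +
  fixes \<alpha> :: "'v \<Rightarrow> 'k" and \<omega> :: "'v \<Rightarrow> 'v \<Rightarrow> 'k"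
  assumes alpha_linear: "linear_form_on scale J \<alpha>"
    and omega_bilinear: "bilinear_form_on scale J \<omega>"
    and omega_skew: "x \<in> J \<Longrightarrow> y \<in> J \<Longrightarrow> \<omega> x y = - \<omega> y x"
    and nondegenerate: "\<exists>n. dim J = 2 * n + 1 \<and>
      nonzero_form_on (2 * n + 1) J
        (wedge 1 (n * 2) (one_form \<alpha>) (wedge_power 2 (two_form \<omega>) n))"
    and alpha_mult: "x \<in> J \<Longrightarrow> y \<in> J \<Longrightarrow> \<alpha> (mult x y) = 0"
    and omega_closed: "x \<in> J \<Longrightarrow> y \<in> J \<Longrightarrow> z \<in> J \<Longrightarrow>
      \<omega> (mult x y) z + \<omega> (mult z x) y + \<omega> (mult y z) x = 0"

text \<open>
  The space \<open>\<langle>d\<rangle> \<oplus> J \<oplus> \<langle>e\<rangle>\<close> is encoded by triples: \<open>(s, x, t)\<close> stands for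
  \<open>s d + x + t e\<close>.
\<close>

definition ext_scale ::
  "('k::field \<Rightarrow> 'v \<Rightarrow> 'v) \<Rightarrow> 'k \<Rightarrow> 'k \<times> 'v \<times> 'k \<Rightarrow> 'k \<times> 'v \<times> 'k" where
  "ext_scale scale c = (\<lambda>(s, x, t). (c * s, scale c x, c * t))"

definition ext_carrier :: "'v set \<Rightarrow> ('k \<times> 'v \<times> 'k) set" where
  "ext_carrier J = UNIV \<times> J \<times> UNIV"

text \<open>
  Bilinear commutative extension of \<open>x \<bullet> y = x \<cdot> y + \<theta>(x, y) e\<close>,
  \<open>d \<bullet> x = \<phi>(x) + \<lambda>(x) e\<close>, \<open>d \<bullet> d = a\<close>, with all products with \<open>e\<close> zero.
\<close>

definition ext_mult ::
  "('k::field \<Rightarrow> 'v::ab_group_add \<Rightarrow> 'v) \<Rightarrow> ('v \<Rightarrow> 'v \<Rightarrow> 'v) \<Rightarrow>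
   ('v \<Rightarrow> 'v \<Rightarrow> 'k) \<Rightarrow> ('v \<Rightarrow> 'v) \<Rightarrow> ('v \<Rightarrow> 'k) \<Rightarrow> 'v \<Rightarrow>
   'k \<times> 'v \<times> 'k \<Rightarrow> 'k \<times> 'v \<times> 'k \<Rightarrow> 'k \<times> 'v \<times> 'k" where
  "ext_mult scale mult \<theta> \<phi> lam a = (\<lambda>(s, x, t) (s', x', t').
     (0,
      mult x x' + scale s (\<phi> x') + scale s' (\<phi> x) + scale (s * s') a,
      \<theta> x x' + s * lam x' + s' * lam x))"

definition jj_double_extension ::
  "('k::field \<Rightarrow> 'v::ab_group_add \<Rightarrow> 'v) \<Rightarrow> 'v set \<Rightarrow> ('v \<Rightarrow> 'v \<Rightarrow> 'v) \<Rightarrow>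
   ('v \<Rightarrow> 'v \<Rightarrow> 'k) \<Rightarrow> ('v \<Rightarrow> 'v) \<Rightarrow> ('v \<Rightarrow> 'k) \<Rightarrow> 'v \<Rightarrow> bool" where
  "jj_double_extension scale J mult \<theta> \<phi> lam a \<longleftrightarrow>
     jj_algebra scale J mult \<and>
     bilinear_form_on scale J \<theta> \<and> (\<forall>x\<in>J. \<forall>y\<in>J. \<theta> x y = \<theta> y x) \<and>
     linear_map_on scale scale J J \<phi> \<and>
     linear_form_on scale J lam \<and>
     a \<in> J \<and>
     jj_algebra (ext_scale scale) (ext_carrier J) (ext_mult scale mult \<theta> \<phi> lam a)"

definition jj_isomorphism ::
  "('k::field \<Rightarrow> 'v::ab_group_add \<Rightarrow> 'v) \<Rightarrow> 'v set \<Rightarrow> ('v \<Rightarrow> 'v \<Rightarrow> 'v) \<Rightarrow>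
   ('k \<Rightarrow> 'w::ab_group_add \<Rightarrow> 'w) \<Rightarrow> 'w set \<Rightarrow> ('w \<Rightarrow> 'w \<Rightarrow> 'w) \<Rightarrow> ('v \<Rightarrow> 'w) \<Rightarrow> bool" where
  "jj_isomorphism s1 J1 m1 s2 J2 m2 f \<longleftrightarrow>
     linear_map_on s1 s2 J1 J2 f \<and> bij_betw f J1 J2 \<and>
     (\<forall>x\<in>J1. \<forall>y\<in>J1. f (m1 x y) = m2 (f x) (f y))"

text \<open>
  The algebra \<open>(Jt, multt, \<alpha>t, \<omega>t)\<close> is a double extension of
  \<open>(J, mult, \<alpha>, \<omega>)\<close>. The structures are carried along by pulling them back
  along the isomorphism \<open>f\<close>; the values of \<open>\<alpha>t\<close> on \<open>d\<close> and \<open>e\<close> are arbitrary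
  scalars.
\<close>

definition cosymplectic_double_extension ::
  "('k::field \<Rightarrow> 'w::ab_group_add \<Rightarrow> 'w) \<Rightarrow> 'w set \<Rightarrow> ('w \<Rightarrow> 'w \<Rightarrow> 'w) \<Rightarrow>
     ('w \<Rightarrow> 'k) \<Rightarrow> ('w \<Rightarrow> 'w \<Rightarrow> 'k) \<Rightarrow>
   ('k \<Rightarrow> 'v::ab_group_add \<Rightarrow> 'v) \<Rightarrow> 'v set \<Rightarrow> ('v \<Rightarrow> 'v \<Rightarrow> 'v) \<Rightarrow>
     ('v \<Rightarrow> 'k) \<Rightarrow> ('v \<Rightarrow> 'v \<Rightarrow> 'k) \<Rightarrow> bool" where
  "cosymplectic_double_extension scalet Jt multt \<alpha>t \<omega>t scale J mult \<alpha> \<omega> \<longleftrightarrow>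
     cosymplectic_jj_algebra scalet Jt multt \<alpha>t \<omega>t \<and>
     cosymplectic_jj_algebra scale J mult \<alpha> \<omega> \<and>
     (\<exists>\<theta> \<phi> lam a f.
        jj_double_extension scale J mult \<theta> \<phi> lam a \<and>
        jj_isomorphism (ext_scale scale) (ext_carrier J) (ext_mult scale mult \<theta> \<phi> lam a)
          scalet Jt multt f \<and>
        (\<forall>x\<in>J. \<forall>y\<in>J. \<omega>t (f (0, x, 0)) (f (0, y, 0)) = \<omega> x y) \<and>
        (\<forall>x\<in>J. \<alpha>t (f (0, x, 0)) = \<alpha> x) \<and>
        \<omega>t (f (1, 0, 0)) (f (0, 0, 1)) = 1 \<and>
        (\<forall>x\<in>J. \<omega>t (f (1, 0, 0)) (f (0, x, 0)) = 0) \<and>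
        (\<forall>x\<in>J. \<omega>t (f (0, 0, 1)) (f (0, x, 0)) = 0))"

end

theory Submission
  imports Defs
begin

text \<open>
  The idea is symplectic reduction by a vector \<open>e \<noteq> 0\<close> with \<open>\<alpha> e = 0\<close> and \<open>x \<cdot> e = 0\<close> for
  all \<open>x\<close>.

  Such an \<open>e\<close> exists by an analogue of Engel's theorem (\<open>common_annihilated_vector\<close>). In
  characteristic other than 2 and 3 every cube \<open>x \<cdot> x\<^sup>2\<close> vanishes, the product by \<open>x\<^sup>2\<close> is
  \<open>-2\<close> times the square of the product by \<open>x\<close>, and therefore the product by \<open>x\<close> has cube zero.
  Hence the algebra acts by simultaneously nilpotent maps, and as all products lie in the kernel
  of \<open>\<alpha>\<close>, which is nonzero when the dimension is at least 3, some nonzero vector of this kernel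
  is annihilated.

  The condition \<open>\<alpha> \<and> \<omega>\<^sup>n \<noteq> 0\<close> makes \<open>\<omega>(e, -)\<close> nonzero, so there is \<open>d\<close> with
  \<open>\<omega>(d, e) = 1\<close>. Let \<open>J\<close> be the \<open>\<omega>\<close>-orthogonal complement of \<open>d\<close> and \<open>e\<close> (\<open>perp\<close>); the whole space is
  \<open>\<langle>d\<rangle> \<oplus> J \<oplus> \<langle>e\<rangle>\<close>. Closedness of \<open>\<omega>\<close> shows that products are \<open>\<omega>\<close>-orthogonal to \<open>e\<close>, so they have
  no \<open>d\<close>-component, and that \<open>3 \<omega>(d \<cdot> d, d) = 0\<close>, so \<open>d \<cdot> d\<close> lies in \<open>J\<close>. Dropping the
  \<open>e\<close>-component of products makes \<open>J\<close> a JJ-algebra, because \<open>e\<close> annihilates everything; the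
  \<open>e\<close>-components themselves give \<open>\<theta>\<close> and \<open>\<lambda>\<close>. The forms restrict to \<open>J\<close> because \<open>\<alpha> e = 0\<close>
  and \<open>J\<close> is orthogonal to \<open>e\<close>.

  What remains is that \<open>\<alpha> \<and> \<omega>\<^sup>n\<^sup>-\<^sup>1\<close> is nonzero on \<open>J\<close>. Contracting \<open>\<alpha> \<and> \<omega>\<^sup>n\<close> with \<open>e\<close> and then
  \<open>d\<close> gives \<open>n \<omega>(e, d)\<close> times it on lists from \<open>J\<close>
  (\<open>cosymplectic_volume_hyperbolic_plane\<close>), and a nonzero form of top degree does not vanish on
  a basis starting with \<open>e\<close> and \<open>d\<close> (\<open>top_form_nonzero_on_basis\<close>). The factor
  \<open>n\<close> is harmless in every characteristic: a nonzero product has nonzero factors. The contractions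
  are computed with a recursive form of the wedge product, for which contraction is a graded
  derivation by definition.
\<close>

section \<open>The shuffle product\<close>

definition contract :: "'v \<Rightarrow> ('v list \<Rightarrow> 'k) \<Rightarrow> 'v list \<Rightarrow> 'k" where
  "contract v \<eta> = (\<lambda>ws. \<eta> (v # ws))"

text \<open>
  The grading involution, which carries the sign in the product rule for contraction.
\<close>

definition parity :: "('v list \<Rightarrow> 'k::comm_ring_1) \<Rightarrow> 'v list \<Rightarrow> 'k" where
  "parity \<eta> = (\<lambda>ws. (- 1) ^ length ws * \<eta> ws)"

text \<open>
  The wedge product of forms of all degrees at once: a form is a function on lists of any
  length. Recursion on the list says that contraction with the first argument is a graded
  derivation, which is all that the later computations need; by \<open>homogeneous_part_wedge\<close> this is the
  wedge product by shuffles on homogeneous forms.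
\<close>

primrec shuffle_prod ::
  "('v list \<Rightarrow> 'k::comm_ring_1) \<Rightarrow> ('v list \<Rightarrow> 'k) \<Rightarrow> 'v list \<Rightarrow> 'k" (infixl "\<diamondop>" 70) where
  "(\<eta> \<diamondop> \<zeta>) [] = \<eta> [] * \<zeta> []"
| "(\<eta> \<diamondop> \<zeta>) (v # vs) = (contract v \<eta> \<diamondop> \<zeta>) vs + (parity \<eta> \<diamondop> contract v \<zeta>) vs"

text \<open>
  A \<open>p\<close>-form given by a formula may take arbitrary values on lists of other lengths; the product
  above sees all lengths, so these values are cut off.
\<close>

definition homogeneous_part :: "nat \<Rightarrow> ('v list \<Rightarrow> 'k::zero) \<Rightarrow> 'v list \<Rightarrow> 'k" where
  "homogeneous_part p \<eta> = (\<lambda>ws. if length ws = p then \<eta> ws else 0)"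

definition inversions :: "nat \<Rightarrow> nat set \<Rightarrow> nat" where
  "inversions n S = card {(i, j). i \<in> S \<and> j \<in> {..<n} - S \<and> j < i}"

lemma sum_Pow_lessThan_Suc:
  "(\<Sum>S\<in>Pow {..<Suc n}. g S) =
     (\<Sum>S\<in>Pow {..<n}. g (insert 0 (Suc ` S))) + (\<Sum>S\<in>Pow {..<n}. g (Suc ` S))"
proof -
  have "{..<Suc n} = insert 0 (Suc ` {..<n})"
    by (simp add: lessThan_Suc_eq_insert_0)
  then have split: "Pow {..<Suc n} = image Suc ` Pow {..<n} \<union> insert 0 ` image Suc ` Pow {..<n}"
    by (simp only: Pow_insert image_Pow_surj)
  have disj: "image Suc ` Pow {..<n} \<inter> insert 0 ` image Suc ` Pow {..<n} = {}"
    by auto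
  have inj1: "inj_on (image Suc) (Pow {..<n})"
    by (meson inj_Suc inj_on_image inj_on_subset subset_UNIV)
  have inj2: "inj_on (insert 0) (image Suc ` Pow {..<n})"
  proof (rule inj_onI)
    fix A B assume "A \<in> image Suc ` Pow {..<n}" "B \<in> image Suc ` Pow {..<n}"
    then have "0 \<notin> A" "0 \<notin> B" by auto
    moreover assume "insert 0 A = insert 0 B"
    ultimately show "A = B" by (metis insert_ident)
  qed
  show ?thesis
    unfolding split
    by (subst sum.union_disjoint)
      (simp_all add: disj sum.reindex inj1 inj2 o_def add.commute)
qed

lemma inversions_insert_0_Suc: "inversions (Suc n) (insert 0 (Suc ` S)) = inversions n S"
proof -
  have "{(i, j). i \<in> insert 0 (Suc ` S) \<and> j \<in> {..<Suc n} - insert 0 (Suc ` S) \<and> j < i}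
      = map_prod Suc Suc ` {(i, j). i \<in> S \<and> j \<in> {..<n} - S \<and> j < i}" (is "?L = ?R")
  proof
    show "?L \<subseteq> ?R"
    proof
      fix p assume "p \<in> ?L"
      then obtain i j where p: "p = (i, j)" "i \<in> insert 0 (Suc ` S)" "j < Suc n"
        "j \<notin> insert 0 (Suc ` S)" "j < i" by auto
      then obtain i' j' where "i = Suc i'" "j = Suc j'" "i' \<in> S"
        by (cases j) auto
      with p show "p \<in> ?R"
        by (intro image_eqI[where x="(i', j')"]) auto
    qed
  qed auto
  then show ?thesis
    unfolding inversions_def
    by (simp add: card_image inj_on_def map_prod_def case_prod_unfold prod_eq_iff)
qed

lemma inversions_Suc:
  assumes "S \<subseteq> {..<n}"
  shows "inversions (Suc n) (Suc ` S) = card S + inversions n S"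
proof -
  let ?I = "{(i, j). i \<in> S \<and> j \<in> {..<n} - S \<and> j < i}"
  have fin: "finite S" using assms finite_subset by blast
  have "?I \<subseteq> S \<times> {..<n}" by auto
  with fin have finI: "finite ?I"
    by (meson finite_SigmaI finite_lessThan finite_subset)
  have "{(i, j). i \<in> Suc ` S \<and> j \<in> {..<Suc n} - Suc ` S \<and> j < i}
      = (\<lambda>i. (Suc i, 0)) ` S \<union> map_prod Suc Suc ` ?I" (is "?L = ?A \<union> ?B")
  proof
    show "?L \<subseteq> ?A \<union> ?B"
    proof
      fix p assume "p \<in> ?L"
      then obtain i j where p: "p = (Suc i, j)" "i \<in> S" "j < Suc n" "j \<notin> Suc ` S" "j < Suc i"
        by auto
      show "p \<in> ?A \<union> ?B"
      proof (cases j)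
        case 0
        with p show ?thesis by auto
      next
        case (Suc j')
        with p have "(i, j') \<in> ?I" by auto
        then have "p \<in> ?B" unfolding p(1) Suc by (intro image_eqI[where x="(i, j')"]) simp_all
        then show ?thesis ..
      qed
    qed
  qed auto
  moreover have "card ((\<lambda>i. (Suc i, 0::nat)) ` S \<union> map_prod Suc Suc ` ?I)
      = card ((\<lambda>i. (Suc i, 0::nat)) ` S) + card (map_prod Suc Suc ` ?I)"
    by (rule card_Un_disjoint) (use fin finI in auto)
  moreover have "card ((\<lambda>i. (Suc i, 0::nat)) ` S) = card S"
    by (simp add: card_image inj_on_def)
  moreover have "card (map_prod Suc Suc ` ?I) = card ?I"
    by (simp add: card_image inj_on_def map_prod_def case_prod_unfold prod_eq_iff)
  ultimately show ?thesis by (simp add: inversions_def)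
qed

lemma length_nths_subset:
  assumes "S \<subseteq> {..<length vs}" shows "length (nths vs S) = card S"
proof -
  have "{i. i < length vs \<and> i \<in> S} = S" using assms by auto
  then show ?thesis by (simp add: length_nths)
qed

text \<open>
  The first argument \<open>v\<close> goes either to \<open>\<eta>\<close>, without creating inversions, or to \<open>\<zeta>\<close>, where it is
  inverted with every position passed to \<open>\<eta>\<close>. The latter accounts for the grading involution.
\<close>

lemma shuffle_prod_eq_sum:
  "(\<eta> \<diamondop> \<zeta>) vs =
     (\<Sum>S\<in>Pow {..<length vs}. (- 1) ^ inversions (length vs) S
        * \<eta> (nths vs S) * \<zeta> (nths vs ({..<length vs} - S)))"
proof (induction vs arbitrary: \<eta> \<zeta>)
  case Nil
  then show ?case by (simp add: inversions_def)
next
  case (Cons v vs)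
  let ?n = "length vs"
  have c1: "{j. Suc j \<in> insert 0 (Suc ` S)} = S" "{j. Suc j \<in> Suc ` S} = S"
    "{j. Suc j \<in> {..<Suc ?n} - insert 0 (Suc ` S)} = {..<?n} - S"
    "{j. Suc j \<in> {..<Suc ?n} - Suc ` S} = {..<?n} - S" for S
    by auto
  have "(\<Sum>S\<in>Pow {..<?n}. (- 1) ^ inversions (Suc ?n) (insert 0 (Suc ` S))
        * \<eta> (nths (v # vs) (insert 0 (Suc ` S)))
        * \<zeta> (nths (v # vs) ({..<Suc ?n} - insert 0 (Suc ` S))))
      = (contract v \<eta> \<diamondop> \<zeta>) vs"
    unfolding Cons.IH nths_Cons c1
    by (intro sum.cong refl) (simp add: contract_def inversions_insert_0_Suc)
  moreover have "(\<Sum>S\<in>Pow {..<?n}. (- 1) ^ inversions (Suc ?n) (Suc ` S)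
        * \<eta> (nths (v # vs) (Suc ` S)) * \<zeta> (nths (v # vs) ({..<Suc ?n} - Suc ` S)))
      = (parity \<eta> \<diamondop> contract v \<zeta>) vs"
    unfolding Cons.IH nths_Cons c1
    by (intro sum.cong refl)
      (auto simp: contract_def parity_def inversions_Suc length_nths_subset power_add)
  ultimately show ?case
    by (simp add: sum_Pow_lessThan_Suc)
qed

lemma homogeneous_part_wedge:
  "homogeneous_part (p + q) (wedge p q \<eta> \<zeta>) = homogeneous_part p \<eta> \<diamondop> homogeneous_part q \<zeta>"
proof
  fix vs :: "'a list"
  let ?n = "length vs"
  let ?g = "\<lambda>S. (- 1) ^ inversions ?n S * homogeneous_part p \<eta> (nths vs S)
        * homogeneous_part q \<zeta> (nths vs ({..<?n} - S))"
  have len: "length (nths vs S) = card S" "length (nths vs ({..<?n} - S)) = ?n - card S"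
      "card S \<le> ?n" if "S \<subseteq> {..<?n}" for S
    using that card_mono[OF _ that]
    by (auto simp: length_nths_subset card_Diff_subset finite_subset)
  show "homogeneous_part (p + q) (wedge p q \<eta> \<zeta>) vs
      = (homogeneous_part p \<eta> \<diamondop> homogeneous_part q \<zeta>) vs"
  proof (cases "?n = p + q")
    case True
    have "(\<Sum>S\<in>Pow {..<?n}. ?g S) = (\<Sum>S | S \<subseteq> {..<?n} \<and> card S = p. ?g S)"
      by (rule sum.mono_neutral_right) (auto simp: homogeneous_part_def len)
    also have "\<dots> = wedge p q \<eta> \<zeta> vs"
      unfolding wedge_def True[symmetric]
      by (rule sum.cong) (use len(1,2) True in \<open>auto simp: homogeneous_part_def inversions_def\<close>)
    finally show ?thesis
      by (simp add: shuffle_prod_eq_sum homogeneous_part_def[of "p + q"] True)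
  next
    case False
    have "?g S = 0" if "S \<in> Pow {..<?n}" for S
    proof -
      have "\<not> (card S = p \<and> ?n - card S = q)" using len(3)[of S] that False by auto
      moreover have "length (nths vs S) = card S" "length (nths vs ({..<?n} - S)) = ?n - card S"
        using that len by blast+
      ultimately show ?thesis by (simp only: homogeneous_part_def) auto
    qed
    then show ?thesis
      using False by (simp add: shuffle_prod_eq_sum homogeneous_part_def[of "p + q"])
  qed
qed

lemma parity_contract: "parity (contract v \<eta>) = (\<lambda>ws. - contract v (parity \<eta>) ws)"
  by (simp add: parity_def contract_def fun_eq_iff)

lemma parity_parity [simp]: "parity (parity \<eta>) = \<eta>"
  by (simp add: parity_def fun_eq_iff mult.assoc[symmetric] power_add[symmetric])

lemma contract_shuffle_prod:
  "contract v (\<eta> \<diamondop> \<zeta>) = (\<lambda>ws. (contract v \<eta> \<diamondop> \<zeta>) ws + (parity \<eta> \<diamondop> contract v \<zeta>) ws)"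
  by (simp add: contract_def)

lemma shuffle_prod_cong:
  assumes "\<And>ws. set ws \<subseteq> X \<Longrightarrow> \<eta> ws = \<eta>' ws" "\<And>ws. set ws \<subseteq> X \<Longrightarrow> \<zeta> ws = \<zeta>' ws" "set vs \<subseteq> X"
  shows "(\<eta> \<diamondop> \<zeta>) vs = (\<eta>' \<diamondop> \<zeta>') vs"
  using assms
proof (induction vs arbitrary: \<eta> \<eta>' \<zeta> \<zeta>')
  case (Cons v vs)
  have "(contract v \<eta> \<diamondop> \<zeta>) vs = (contract v \<eta>' \<diamondop> \<zeta>') vs"
    "(parity \<eta> \<diamondop> contract v \<zeta>) vs = (parity \<eta>' \<diamondop> contract v \<zeta>') vs"
    by (rule Cons.IH; use Cons.prems in \<open>simp add: contract_def parity_def\<close>)+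
  then show ?case by simp
qed simp

lemma shuffle_prod_add_left: "((\<lambda>ws. \<eta> ws + \<eta>' ws) \<diamondop> \<zeta>) vs = (\<eta> \<diamondop> \<zeta>) vs + (\<eta>' \<diamondop> \<zeta>) vs"
  by (simp add: shuffle_prod_eq_sum sum.distrib[symmetric] algebra_simps)

lemma shuffle_prod_add_right: "(\<eta> \<diamondop> (\<lambda>ws. \<zeta> ws + \<zeta>' ws)) vs = (\<eta> \<diamondop> \<zeta>) vs + (\<eta> \<diamondop> \<zeta>') vs"
  by (simp add: shuffle_prod_eq_sum sum.distrib[symmetric] algebra_simps)

lemma shuffle_prod_scale_left: "((\<lambda>ws. c * \<eta> ws) \<diamondop> \<zeta>) vs = c * (\<eta> \<diamondop> \<zeta>) vs"
  by (simp add: shuffle_prod_eq_sum sum_distrib_left algebra_simps)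

lemma shuffle_prod_scale_right: "(\<eta> \<diamondop> (\<lambda>ws. c * \<zeta> ws)) vs = c * (\<eta> \<diamondop> \<zeta>) vs"
  by (simp add: shuffle_prod_eq_sum sum_distrib_left algebra_simps)

lemma shuffle_prod_minus_left: "((\<lambda>ws. - \<eta> ws) \<diamondop> \<zeta>) vs = - (\<eta> \<diamondop> \<zeta>) vs"
  using shuffle_prod_scale_left[of "- 1"] by simp

lemma shuffle_prod_minus_right: "(\<eta> \<diamondop> (\<lambda>ws. - \<zeta> ws)) vs = - (\<eta> \<diamondop> \<zeta>) vs"
  using shuffle_prod_scale_right[of _ "- 1"] by simp

lemma shuffle_prod_diff_right: "(\<eta> \<diamondop> (\<lambda>ws. \<zeta> ws - \<zeta>' ws)) vs = (\<eta> \<diamondop> \<zeta>) vs - (\<eta> \<diamondop> \<zeta>') vs"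
  by (simp add: shuffle_prod_eq_sum sum_subtractf[symmetric] algebra_simps)

lemma shuffle_prod_eq_0:
  assumes "set vs \<subseteq> X"
    and "(\<forall>ws. set ws \<subseteq> X \<longrightarrow> \<eta> ws = 0) \<or> (\<forall>ws. set ws \<subseteq> X \<longrightarrow> \<zeta> ws = 0)"
  shows "(\<eta> \<diamondop> \<zeta>) vs = 0"
  unfolding shuffle_prod_eq_sum
proof (rule sum.neutral, rule ballI)
  fix S
  have "set (nths vs T) \<subseteq> X" for T using subset_trans[OF set_nths_subset assms(1)] .
  then show "(- 1) ^ inversions (length vs) S * \<eta> (nths vs S)
      * \<zeta> (nths vs ({..<length vs} - S)) = 0"
    using assms(2) by auto
qed

text \<open>
  The induction needs that the grading involution is multiplicative, since it acts on the left
  factor in the product rule.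
\<close>

lemma shuffle_prod_assoc_apply:
  fixes \<eta> \<zeta> \<xi> :: "'v list \<Rightarrow> 'k::comm_ring_1"
  shows "((\<eta> \<diamondop> \<zeta>) \<diamondop> \<xi>) vs = (\<eta> \<diamondop> (\<zeta> \<diamondop> \<xi>)) vs"
proof -
  have parity_mult: "parity (\<eta> \<diamondop> \<zeta>) ws = (parity \<eta> \<diamondop> parity \<zeta>) ws" for \<eta> \<zeta> :: "'v list \<Rightarrow> 'k" and ws
  proof (induction ws arbitrary: \<eta> \<zeta>)
    case (Cons w ws)
    have "parity (\<eta> \<diamondop> \<zeta>) (w # ws)
        = - (parity (contract w \<eta> \<diamondop> \<zeta>) ws + parity (parity \<eta> \<diamondop> contract w \<zeta>) ws)"
      by (simp add: parity_def algebra_simps)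
    also have "\<dots> = (parity \<eta> \<diamondop> parity \<zeta>) (w # ws)"
      by (simp add: Cons.IH parity_contract shuffle_prod_minus_left shuffle_prod_minus_right)
    finally show ?case .
  qed (simp add: parity_def)
  then have parity_mult: "parity (\<eta> \<diamondop> \<zeta>) = parity \<eta> \<diamondop> parity \<zeta>" for \<eta> \<zeta> :: "'v list \<Rightarrow> 'k"
    by blast
  show ?thesis
    by (induction vs arbitrary: \<eta> \<zeta> \<xi>)
      (simp_all add: contract_shuffle_prod shuffle_prod_add_left shuffle_prod_add_right
        parity_mult mult.assoc add.assoc)
qed

lemma shuffle_prod_assoc: "(\<eta> \<diamondop> \<zeta>) \<diamondop> \<xi> = \<eta> \<diamondop> (\<zeta> \<diamondop> \<xi>)"
  using shuffle_prod_assoc_apply by blast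

text \<open>
  Contraction exchanges even and odd forms, so the two parities are proved together.
\<close>

lemma shuffle_prod_graded_commute:
  "(parity \<eta> = \<eta> \<longrightarrow> (\<eta> \<diamondop> \<zeta>) vs = (\<zeta> \<diamondop> \<eta>) vs) \<and>
   (parity \<eta> = (\<lambda>ws. - \<eta> ws) \<longrightarrow> (\<eta> \<diamondop> \<zeta>) vs = (parity \<zeta> \<diamondop> \<eta>) vs)"
proof (induction vs arbitrary: \<eta> \<zeta>)
  case Nil
  then show ?case by (simp add: parity_def mult.commute)
next
  case (Cons v vs)
  show ?case
  proof (intro conjI impI)
    assume even: "parity \<eta> = \<eta>"
    then have odd: "parity (contract v \<eta>) = (\<lambda>ws. - contract v \<eta> ws)"
      by (metis parity_contract)
    have "(contract v \<eta> \<diamondop> \<zeta>) vs = (parity \<zeta> \<diamondop> contract v \<eta>) vs"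
      using Cons.IH[of "contract v \<eta>" \<zeta>] odd by blast
    moreover have "(\<eta> \<diamondop> contract v \<zeta>) vs = (contract v \<zeta> \<diamondop> \<eta>) vs"
      using Cons.IH[of \<eta> "contract v \<zeta>"] even by blast
    ultimately show "(\<eta> \<diamondop> \<zeta>) (v # vs) = (\<zeta> \<diamondop> \<eta>) (v # vs)"
      by (simp only: shuffle_prod.simps even add.commute)
  next
    assume odd: "parity \<eta> = (\<lambda>ws. - \<eta> ws)"
    then have even: "parity (contract v \<eta>) = contract v \<eta>"
      unfolding parity_contract by (simp add: contract_def)
    have "(contract v \<eta> \<diamondop> \<zeta>) vs = (\<zeta> \<diamondop> contract v \<eta>) vs"
      using Cons.IH[of "contract v \<eta>" \<zeta>] even by blast
    moreover have "(\<eta> \<diamondop> contract v \<zeta>) vs = (parity (contract v \<zeta>) \<diamondop> \<eta>) vs"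
      using Cons.IH[of \<eta> "contract v \<zeta>"] odd by blast
    ultimately show "(\<eta> \<diamondop> \<zeta>) (v # vs) = (parity \<zeta> \<diamondop> \<eta>) (v # vs)"
      by (simp only: shuffle_prod.simps odd parity_contract parity_parity
          shuffle_prod_minus_left add.commute minus_minus)
  qed
qed

text \<open>
  The zeroth wedge power is the constant function 1 on lists of every length; only its part of
  degree 0 is the unit of the product.
\<close>

definition unit_form :: "'v list \<Rightarrow> 'k::comm_ring_1" where
  "unit_form = (\<lambda>ws. if ws = [] then 1 else 0)"

lemma contract_unit_form [simp]: "contract v unit_form = (\<lambda>_. 0)"
  by (simp add: contract_def unit_form_def)

lemma shuffle_prod_zero [simp]: "((\<lambda>_. 0) \<diamondop> \<zeta>) vs = 0" "(\<eta> \<diamondop> (\<lambda>_. 0)) vs = 0"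
  by (simp_all add: shuffle_prod_eq_sum)

lemma parity_unit_form [simp]: "parity unit_form = unit_form"
  by (auto simp: parity_def unit_form_def)

lemma shuffle_prod_unit_left: "unit_form \<diamondop> \<eta> = \<eta>"
proof
  fix vs
  show "(unit_form \<diamondop> \<eta>) vs = \<eta> vs"
  proof (induction vs arbitrary: \<eta>)
    case Nil
    show ?case by (simp add: unit_form_def)
  next
    case (Cons v vs)
    then show ?case by (simp add: contract_def[of v \<eta>])
  qed
qed

section \<open>Contraction\<close>

definition covector :: "('v \<Rightarrow> 'k::comm_ring_1) \<Rightarrow> 'v list \<Rightarrow> 'k" where
  "covector \<alpha> = homogeneous_part 1 (one_form \<alpha>)"

primrec form_power :: "('v \<Rightarrow> 'v \<Rightarrow> 'k::comm_ring_1) \<Rightarrow> nat \<Rightarrow> 'v list \<Rightarrow> 'k" where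
  "form_power \<omega> 0 = unit_form"
| "form_power \<omega> (Suc n) = homogeneous_part 2 (two_form \<omega>) \<diamondop> form_power \<omega> n"

lemma homogeneous_part_wedge_power:
  "homogeneous_part (n * 2) (wedge_power 2 (two_form \<omega>) n) = form_power \<omega> n"
proof (induction n)
  case 0
  show ?case by (simp add: homogeneous_part_def unit_form_def)
next
  case (Suc n)
  then show ?case
    using homogeneous_part_wedge[of 2 "n * 2" "two_form \<omega>" "wedge_power 2 (two_form \<omega>) n"] by simp
qed

definition cosymplectic_volume :: "('v \<Rightarrow> 'k::comm_ring_1) \<Rightarrow> ('v \<Rightarrow> 'v \<Rightarrow> 'k) \<Rightarrow> nat \<Rightarrow> 'v list \<Rightarrow> 'k" where
  "cosymplectic_volume \<alpha> \<omega> n = covector \<alpha> \<diamondop> form_power \<omega> n"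

lemma cosymplectic_volume_eq:
  "cosymplectic_volume \<alpha> \<omega> n
    = homogeneous_part (2 * n + 1) (wedge 1 (n * 2) (one_form \<alpha>) (wedge_power 2 (two_form \<omega>) n))"
  using homogeneous_part_wedge[of 1 "n * 2" "one_form \<alpha>" "wedge_power 2 (two_form \<omega>) n"]
  by (simp add: cosymplectic_volume_def covector_def homogeneous_part_wedge_power mult.commute)

lemma nonzero_form_on_iff_cosymplectic_volume:
  "nonzero_form_on (2 * n + 1) J (wedge 1 (n * 2) (one_form \<alpha>) (wedge_power 2 (two_form \<omega>) n))
    \<longleftrightarrow> (\<exists>vs. set vs \<subseteq> J \<and> cosymplectic_volume \<alpha> \<omega> n vs \<noteq> 0)"
  unfolding nonzero_form_on_def cosymplectic_volume_eq by (auto simp: homogeneous_part_def)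

lemma contract_covector: "contract v (covector \<alpha>) = (\<lambda>ws. \<alpha> v * unit_form ws)"
  by (auto simp: contract_def covector_def homogeneous_part_def one_form_def unit_form_def)

lemma parity_covector: "parity (covector \<alpha>) = (\<lambda>ws. - covector \<alpha> ws)"
  by (auto simp: parity_def covector_def homogeneous_part_def)

lemma contract_two_form: "contract v (homogeneous_part 2 (two_form \<omega>)) = covector (\<omega> v)"
  by (auto simp: contract_def covector_def homogeneous_part_def one_form_def two_form_def)

lemma parity_two_form [simp]:
  "parity (homogeneous_part 2 \<eta>) = homogeneous_part 2 \<eta>"
  by (auto simp: parity_def homogeneous_part_def)

text \<open>
  Two-forms commute with everything, so each of the \<open>n\<close> factors contributes the same term.
\<close>

lemma contract_form_power:
  "contract v (form_power \<omega> n) = (\<lambda>ws. of_nat n * (covector (\<omega> v) \<diamondop> form_power \<omega> (n - 1)) ws)"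
proof (induction n)
  case 0
  show ?case by simp
next
  case (Suc n)
  let ?w = "homogeneous_part 2 (two_form \<omega>)"
  have comm: "covector (\<omega> v) \<diamondop> ?w = ?w \<diamondop> covector (\<omega> v)"
    using shuffle_prod_graded_commute[of ?w "covector (\<omega> v)"] by (simp add: fun_eq_iff)
  have "?w \<diamondop> (covector (\<omega> v) \<diamondop> form_power \<omega> (n - 1)) = covector (\<omega> v) \<diamondop> form_power \<omega> n" if "n > 0"
    using that by (cases n) (simp_all add: shuffle_prod_assoc[symmetric] comm)
  then show ?case
    by (cases "n = 0")
      (simp_all add: Suc contract_shuffle_prod contract_two_form shuffle_prod_scale_right
        algebra_simps)
qed

lemma contract_cosymplectic_volume:
  assumes "\<alpha> e = 0"
  shows "cosymplectic_volume \<alpha> \<omega> n (e # ws)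
    = - (of_nat n * (covector \<alpha> \<diamondop> (covector (\<omega> e) \<diamondop> form_power \<omega> (n - 1))) ws)"
  by (simp add: cosymplectic_volume_def contract_covector assms parity_covector
      contract_form_power shuffle_prod_scale_right shuffle_prod_minus_left)

lemma covector_eq_0: "(\<And>x. x \<in> set ws \<Longrightarrow> \<alpha> x = 0) \<Longrightarrow> covector \<alpha> ws = 0"
  by (cases ws) (auto simp: covector_def homogeneous_part_def one_form_def)

lemma cosymplectic_volume_radical_eq_0:
  assumes "\<alpha> e = 0" "\<And>x. x \<in> set ws \<Longrightarrow> \<omega> e x = 0"
  shows "cosymplectic_volume \<alpha> \<omega> n (e # ws) = 0"
proof -
  have "(covector (\<omega> e) \<diamondop> form_power \<omega> (n - 1)) us = 0" if "set us \<subseteq> set ws" for us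
    by (rule shuffle_prod_eq_0[of _ "set ws"]) (use that assms in \<open>auto intro!: covector_eq_0 dest: subsetD\<close>)
  then have "(covector \<alpha> \<diamondop> (covector (\<omega> e) \<diamondop> form_power \<omega> (n - 1))) ws = 0"
    by (intro shuffle_prod_eq_0[of _ "set ws"]) auto
  then show ?thesis by (simp add: contract_cosymplectic_volume assms(1))
qed

text \<open>
  After contraction with \<open>e\<close> the factor \<open>\<omega>(e, -)\<close> vanishes on all remaining arguments except \<open>d\<close>,
  so the second contraction has to remove exactly this factor.
\<close>

lemma cosymplectic_volume_hyperbolic_plane:
  assumes "\<alpha> e = 0" "\<And>x. x \<in> set ws \<Longrightarrow> \<omega> e x = 0"
  shows "cosymplectic_volume \<alpha> \<omega> (Suc n) (e # d # ws)
    = of_nat (Suc n) * \<omega> e d * cosymplectic_volume \<alpha> \<omega> n ws"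
proof -
  let ?e = "covector (\<omega> e)" and ?P = "form_power \<omega> n"
  have van: "(?e \<diamondop> \<zeta>) us = 0" if "set us \<subseteq> set ws" for us \<zeta>
    by (rule shuffle_prod_eq_0[of _ "set ws"]) (use that assms in \<open>auto intro!: covector_eq_0 dest: subsetD\<close>)
  have "(covector \<alpha> \<diamondop> (?e \<diamondop> contract d ?P)) ws = 0"
    by (rule shuffle_prod_eq_0[of _ "set ws"]) (use van in auto)
  then have "(covector \<alpha> \<diamondop> (?e \<diamondop> ?P)) (d # ws) = - (\<omega> e d * (covector \<alpha> \<diamondop> ?P) ws)"
    by (simp add: contract_covector parity_covector contract_shuffle_prod
        shuffle_prod_scale_left shuffle_prod_scale_right shuffle_prod_unit_left
        shuffle_prod_minus_left shuffle_prod_minus_right shuffle_prod_add_right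
        shuffle_prod_diff_right van)
  then show ?thesis
    by (simp add: contract_cosymplectic_volume assms(1)) (simp add: cosymplectic_volume_def)
qed

section \<open>Exterior forms and bases\<close>

locale finite_dim_subspace = vector_space scale
  for scale :: "'k::field \<Rightarrow> 'v::ab_group_add \<Rightarrow> 'v" +
  fixes J :: "'v set"
  assumes finitely_spanned: "\<exists>B. finite B \<and> B \<subseteq> J \<and> span B = J"
begin

lemma subspace_J: "subspace J"
  using finitely_spanned subspace_span by metis

definition multilinear :: "('v list \<Rightarrow> 'k) \<Rightarrow> bool" where
  "multilinear \<eta> \<longleftrightarrow> (\<forall>us x y c ws. set us \<union> {x, y} \<union> set ws \<subseteq> J \<longrightarrow>
     \<eta> (us @ (x + y) # ws) = \<eta> (us @ x # ws) + \<eta> (us @ y # ws) \<and>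
     \<eta> (us @ scale c x # ws) = c * \<eta> (us @ x # ws))"

definition alternating :: "('v list \<Rightarrow> 'k) \<Rightarrow> bool" where
  "alternating \<eta> \<longleftrightarrow>
     (\<forall>us x ws. set us \<union> {x} \<union> set ws \<subseteq> J \<longrightarrow> \<eta> (us @ x # x # ws) = 0)"

lemma multilinearD:
  assumes "multilinear \<eta>" "set us \<subseteq> J" "x \<in> J" "set ws \<subseteq> J"
  shows "y \<in> J \<Longrightarrow> \<eta> (us @ (x + y) # ws) = \<eta> (us @ x # ws) + \<eta> (us @ y # ws)"
    and "\<eta> (us @ scale c x # ws) = c * \<eta> (us @ x # ws)"
proof -
  show "\<eta> (us @ (x + y) # ws) = \<eta> (us @ x # ws) + \<eta> (us @ y # ws)" if "y \<in> J"
    using assms that unfolding multilinear_def by simp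
  show "\<eta> (us @ scale c x # ws) = c * \<eta> (us @ x # ws)"
    using assms(1)[unfolded multilinear_def, rule_format, of us x x ws c] assms(2-) by simp
qed

lemma alternatingD:
  "alternating \<eta> \<Longrightarrow> set us \<subseteq> J \<Longrightarrow> x \<in> J \<Longrightarrow> set ws \<subseteq> J \<Longrightarrow> \<eta> (us @ x # x # ws) = 0"
  unfolding alternating_def by simp

lemma multilinear_contract:
  assumes "multilinear \<eta>" "v \<in> J"
  shows "multilinear (contract v \<eta>)"
  unfolding multilinear_def contract_def
proof (intro allI impI)
  fix us x y c ws assume "set us \<union> {x, y} \<union> set ws \<subseteq> J"
  then show "\<eta> (v # us @ (x + y) # ws) = \<eta> (v # us @ x # ws) + \<eta> (v # us @ y # ws) \<and>
     \<eta> (v # us @ scale c x # ws) = c * \<eta> (v # us @ x # ws)"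
    using assms(1)[unfolded multilinear_def, rule_format, of "v # us" x y ws c] assms(2) by simp
qed

lemma alternating_contract:
  assumes "alternating \<eta>" "v \<in> J"
  shows "alternating (contract v \<eta>)"
  unfolding alternating_def contract_def
proof (intro allI impI)
  fix us x ws assume "set us \<union> {x} \<union> set ws \<subseteq> J"
  then show "\<eta> (v # us @ x # x # ws) = 0"
    using assms(1)[unfolded alternating_def, rule_format, of "v # us" x ws] assms(2) by simp
qed

lemma multilinear_parity: "multilinear \<eta> \<Longrightarrow> multilinear (parity \<eta>)"
  unfolding multilinear_def parity_def by (auto simp: algebra_simps)

lemma alternating_parity: "alternating \<eta> \<Longrightarrow> alternating (parity \<eta>)"
  unfolding alternating_def parity_def by auto

lemma multilinear_shuffle_prod:
  assumes "multilinear \<eta>" "multilinear \<zeta>"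
  shows "multilinear (\<eta> \<diamondop> \<zeta>)"
proof -
  have "(\<eta> \<diamondop> \<zeta>) (us @ (x + y) # ws) = (\<eta> \<diamondop> \<zeta>) (us @ x # ws) + (\<eta> \<diamondop> \<zeta>) (us @ y # ws) \<and>
     (\<eta> \<diamondop> \<zeta>) (us @ scale c x # ws) = c * (\<eta> \<diamondop> \<zeta>) (us @ x # ws)"
    if "set us \<subseteq> J" "x \<in> J" "y \<in> J" "set ws \<subseteq> J" for us x y c ws
    using that(1) assms
  proof (induction us arbitrary: \<eta> \<zeta>)
    case Nil
    have add: "contract (x + y) \<eta> us = contract x \<eta> us + contract y \<eta> us"
      and scl: "contract (scale c x) \<eta> us = c * contract x \<eta> us"
      if "multilinear \<eta>" "set us \<subseteq> J" for \<eta> us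
      using multilinearD[OF that(1), of "[]" x us] \<open>x \<in> J\<close> \<open>y \<in> J\<close> that(2)
      by (simp_all add: contract_def)
    note cong = shuffle_prod_cong[OF _ _ that(4)]
    have "(contract (x + y) \<eta> \<diamondop> \<zeta>) ws = (contract x \<eta> \<diamondop> \<zeta>) ws + (contract y \<eta> \<diamondop> \<zeta>) ws"
      unfolding shuffle_prod_add_left[symmetric] by (rule cong) (simp_all add: add Nil)
    moreover have "(parity \<eta> \<diamondop> contract (x + y) \<zeta>) ws
        = (parity \<eta> \<diamondop> contract x \<zeta>) ws + (parity \<eta> \<diamondop> contract y \<zeta>) ws"
      unfolding shuffle_prod_add_right[symmetric] by (rule cong) (simp_all add: add Nil)
    moreover have "(contract (scale c x) \<eta> \<diamondop> \<zeta>) ws = c * (contract x \<eta> \<diamondop> \<zeta>) ws"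
      unfolding shuffle_prod_scale_left[symmetric] by (rule cong) (simp_all add: scl Nil)
    moreover have "(parity \<eta> \<diamondop> contract (scale c x) \<zeta>) ws = c * (parity \<eta> \<diamondop> contract x \<zeta>) ws"
      unfolding shuffle_prod_scale_right[symmetric] by (rule cong) (simp_all add: scl Nil)
    ultimately show ?case by (simp add: algebra_simps)
  next
    case (Cons u us)
    then have u: "u \<in> J" "set us \<subseteq> J" by auto
    show ?case
      using Cons.IH[of "contract u \<eta>" \<zeta>] Cons.IH[of "parity \<eta>" "contract u \<zeta>"] Cons.prems u
      by (simp add: multilinear_contract multilinear_parity algebra_simps)
  qed
  then show ?thesis unfolding multilinear_def by auto
qed

text \<open>
  In the square of a contraction the two mixed terms cancel, since contraction anticommutes
  with the sign of the degree.
\<close>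

lemma alternating_shuffle_prod:
  assumes "alternating \<eta>" "alternating \<zeta>"
  shows "alternating (\<eta> \<diamondop> \<zeta>)"
proof -
  have "(\<eta> \<diamondop> \<zeta>) (us @ x # x # ws) = 0"
    if "set us \<subseteq> J" "x \<in> J" "set ws \<subseteq> J" for us x ws
    using that(1) assms
  proof (induction us arbitrary: \<eta> \<zeta>)
    case Nil
    have z: "contract x (contract x \<eta>) us = 0" if "alternating \<eta>" "set us \<subseteq> J" for \<eta> us
      using alternatingD[OF that(1), of "[]" x us] that(2) \<open>x \<in> J\<close> by (simp add: contract_def)
    have "(contract x (contract x \<eta>) \<diamondop> \<zeta>) ws = 0" "(\<eta> \<diamondop> contract x (contract x \<zeta>)) ws = 0"
      by (rule shuffle_prod_eq_0[OF that(3)]; use z Nil in blast)+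
    then show ?case by (simp add: parity_contract shuffle_prod_minus_left)
  next
    case (Cons u us)
    then have u: "u \<in> J" "set us \<subseteq> J" by auto
    show ?case
      using Cons.IH[of "contract u \<eta>" \<zeta>] Cons.IH[of "parity \<eta>" "contract u \<zeta>"] Cons.prems u
      by (simp add: alternating_contract alternating_parity)
  qed
  then show ?thesis unfolding alternating_def by auto
qed

lemma alternating_swap:
  assumes \<eta>: "multilinear \<eta>" "alternating \<eta>"
    and "set us \<subseteq> J" "x \<in> J" "y \<in> J" "set ws \<subseteq> J"
  shows "\<eta> (us @ y # x # ws) = - \<eta> (us @ x # y # ws)"
proof -
  have xy: "x + y \<in> J" using assms subspace_J by (simp add: subspace_add)
  have "0 = \<eta> (us @ (x + y) # (x + y) # ws)"
    using alternatingD[OF \<eta>(2)] assms xy by simp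
  also have "\<dots> = \<eta> (us @ x # (x + y) # ws) + \<eta> (us @ y # (x + y) # ws)"
    using multilinearD(1)[OF \<eta>(1), of us x "(x + y) # ws" y] assms xy by simp
  also have "\<dots> = \<eta> (us @ x # x # ws) + \<eta> (us @ x # y # ws)
      + (\<eta> (us @ y # x # ws) + \<eta> (us @ y # y # ws))"
    using multilinearD(1)[OF \<eta>(1), of "us @ [x]" x ws y]
      multilinearD(1)[OF \<eta>(1), of "us @ [y]" x ws y] assms by simp
  also have "\<dots> = \<eta> (us @ x # y # ws) + \<eta> (us @ y # x # ws)"
    using alternatingD[OF \<eta>(2)] assms by simp
  finally show ?thesis by (simp add: eq_neg_iff_add_eq_0 add.commute)
qed

text \<open>
  Only the vanishing of values on reordered lists matters in what follows, so signs of
  permutations need not be tracked.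
\<close>

lemma alternating_move_to_front:
  assumes \<eta>: "multilinear \<eta>" "alternating \<eta>"
    and "x \<in> J" "set ws \<subseteq> J" "set us \<subseteq> J"
  shows "\<eta> (us @ x # ws) = 0 \<longleftrightarrow> \<eta> (x # us @ ws) = 0"
  using assms(4,5)
proof (induction us arbitrary: ws rule: rev_induct)
  case (snoc u us)
  then show ?case
    using alternating_swap[OF \<eta>, of us x u ws] snoc.IH[of "u # ws"] assms(3) by simp
qed simp

lemma alternating_repeated:
  assumes \<eta>: "multilinear \<eta>" "alternating \<eta>"
    and "set vs \<subseteq> J" "\<not> distinct vs"
  shows "\<eta> vs = 0"
proof -
  obtain us x ws zs where vs: "vs = us @ [x] @ ws @ [x] @ zs"
    using not_distinct_decomp[OF assms(4)] by blast
  have "\<eta> vs = 0 \<longleftrightarrow> \<eta> (x # us @ ws @ [x] @ zs) = 0"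
    using alternating_move_to_front[OF \<eta>, of x "ws @ [x] @ zs" us] assms(3) vs by simp
  also have "\<dots> \<longleftrightarrow> \<eta> (x # x # us @ ws @ zs) = 0"
    using alternating_move_to_front[OF multilinear_contract[OF \<eta>(1)]
        alternating_contract[OF \<eta>(2)], of x x zs "us @ ws"] assms(3) vs
    by (simp add: contract_def)
  finally show ?thesis using alternatingD[OF \<eta>(2), of "[]" x] assms(3) vs by simp
qed

lemma multilinear_eq_0_if_spanning:
  assumes "span B = J" "multilinear \<eta>" "\<And>ws. set ws \<subseteq> B \<Longrightarrow> \<eta> ws = 0" "set vs \<subseteq> J"
  shows "\<eta> vs = 0"
  using assms(2-)
proof (induction vs arbitrary: \<eta>)
  case Nil
  then show ?case by simp
next
  case (Cons v vs)
  have BJ: "B \<subseteq> J" using assms(1) span_superset by auto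
  have "\<eta> (v # ws) = 0" if ws: "set ws \<subseteq> B" for ws
  proof -
    have wsJ: "set ws \<subseteq> J" using ws BJ by auto
    let ?N = "{x \<in> J. \<eta> (x # ws) = 0}"
    note lin = multilinearD[OF Cons.prems(1), of "[]" _ ws, simplified]
    have "subspace ?N"
      unfolding subspace_def
    proof (intro conjI ballI allI)
      have "\<eta> (scale 0 0 # ws) = 0 * \<eta> (0 # ws)"
        by (rule lin(2)) (use subspace_J wsJ in \<open>auto simp: subspace_0\<close>)
      then show "0 \<in> ?N" using subspace_J by (simp add: subspace_0)
    next
      fix x y assume "x \<in> ?N" "y \<in> ?N"
      then show "x + y \<in> ?N" using lin(1)[of x y] subspace_J wsJ by (simp add: subspace_add)
    next
      fix c x assume "x \<in> ?N"
      then show "scale c x \<in> ?N" using lin(2)[of x c] subspace_J wsJ by (simp add: subspace_scale)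
    qed
    moreover have "B \<subseteq> ?N" using Cons.prems(2) ws BJ by auto
    ultimately have "J \<subseteq> ?N" using span_minimal assms(1) by metis
    then show ?thesis using Cons.prems(3) by auto
  qed
  then have "contract v \<eta> vs = 0"
    using Cons.IH[of "contract v \<eta>"] Cons.prems multilinear_contract
    by (simp add: contract_def)
  then show ?case by (simp add: contract_def)
qed

lemma alternating_bring_to_front:
  assumes "multilinear \<eta>" "alternating \<eta>" "\<eta> ws \<noteq> 0" "set ws \<subseteq> J"
    and "distinct ps" "set ps \<subseteq> set ws"
  shows "\<exists>zs. set zs \<subseteq> set ws - set ps \<and> \<eta> (ps @ zs) \<noteq> 0"
  using assms
proof (induction ps arbitrary: \<eta> ws)
  case Nil
  then show ?case by auto
next
  case (Cons p ps)
  obtain us zs where ws: "ws = us @ p # zs"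
    using Cons.prems(6) by (meson list.set_intros(1) split_list subsetD)
  have dis: "distinct ws" using alternating_repeated Cons.prems(1-4) by blast
  have nz: "contract p \<eta> (us @ zs) \<noteq> 0"
    using alternating_move_to_front[of \<eta> p zs us] Cons.prems(1-4) ws by (simp add: contract_def)
  have "\<exists>xs. set xs \<subseteq> set (us @ zs) - set ps \<and> contract p \<eta> (ps @ xs) \<noteq> 0"
    by (rule Cons.IH[OF multilinear_contract alternating_contract nz])
      (use Cons.prems ws in auto)
  then show ?case using dis ws by (auto simp: contract_def)
qed

text \<open>
  By multilinearity the form is nonzero on some list of basis vectors. In top degree such a list
  has no repetition, hence exhausts the basis, and any given basis vectors can be moved to its
  front.
\<close>

lemma top_form_nonzero_on_basis:
  assumes "multilinear \<eta>" "alternating \<eta>" "\<And>ws. \<eta> ws \<noteq> 0 \<Longrightarrow> length ws = card C"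
    and "\<eta> vs \<noteq> 0" "set vs \<subseteq> J"
    and C: "finite C" "span C = J" and ps: "distinct ps" "set ps \<subseteq> C"
  obtains zs where "set zs \<subseteq> C - set ps" "\<eta> (ps @ zs) \<noteq> 0"
proof -
  obtain ws where ws: "set ws \<subseteq> C" "\<eta> ws \<noteq> 0"
    using multilinear_eq_0_if_spanning[OF C(2) assms(1) _ assms(5)] assms(4) by blast
  have wsJ: "set ws \<subseteq> J" using ws(1) C(2) span_superset by blast
  have "distinct ws" using alternating_repeated[OF assms(1,2) wsJ] ws(2) by blast
  then have "card (set ws) = card C" using assms(3)[OF ws(2)] by (simp add: distinct_card)
  then have "set ws = C" using C(1) ws(1) by (simp add: card_subset_eq)
  then show thesis
    using alternating_bring_to_front[OF assms(1,2) ws(2) wsJ ps(1)] ps(2) that by blast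
qed

lemma multilinear_covector: "linear_form_on scale J \<alpha> \<Longrightarrow> multilinear (covector \<alpha>)"
  unfolding multilinear_def linear_map_on_def
  by (auto simp: covector_def homogeneous_part_def one_form_def)

lemma alternating_covector: "alternating (covector \<alpha>)"
  unfolding alternating_def by (auto simp: covector_def homogeneous_part_def)

lemma multilinear_two_form:
  assumes "bilinear_form_on scale J \<omega>"
  shows "multilinear (homogeneous_part 2 (two_form \<omega>))"
  unfolding multilinear_def
proof (intro allI impI)
  fix us x y c ws assume J: "set us \<union> {x, y} \<union> set ws \<subseteq> J"
  let ?w = "homogeneous_part 2 (two_form \<omega>)"
  have \<omega>: "\<omega> (x + y) z = \<omega> x z + \<omega> y z" "\<omega> (scale c x) z = c * \<omega> x z"
    "\<omega> z (x + y) = \<omega> z x + \<omega> z y" "\<omega> z (scale c x) = c * \<omega> z x" if "z \<in> J" for z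
    using assms J that unfolding bilinear_map_on_def linear_map_on_def by auto
  consider z where "us = []" "ws = [z]" | z where "us = [z]" "ws = []" | "length us + length ws \<noteq> 1"
    by (cases us; cases ws) auto
  then show "?w (us @ (x + y) # ws) = ?w (us @ x # ws) + ?w (us @ y # ws) \<and>
     ?w (us @ scale c x # ws) = c * ?w (us @ x # ws)"
    by cases (use J \<omega> in \<open>auto simp: homogeneous_part_def two_form_def\<close>)
qed

lemma alternating_two_form:
  assumes "\<And>x. x \<in> J \<Longrightarrow> \<omega> x x = 0"
  shows "alternating (homogeneous_part 2 (two_form \<omega>))"
  unfolding alternating_def using assms by (auto simp: homogeneous_part_def two_form_def)

lemma exterior_cosymplectic_volume:
  assumes "linear_form_on scale J \<alpha>" "bilinear_form_on scale J \<omega>" "\<And>x. x \<in> J \<Longrightarrow> \<omega> x x = 0"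
  shows "multilinear (cosymplectic_volume \<alpha> \<omega> n)" "alternating (cosymplectic_volume \<alpha> \<omega> n)"
proof -
  have "multilinear (form_power \<omega> n) \<and> alternating (form_power \<omega> n)"
  proof (induction n)
    case 0
    show ?case by (auto simp: multilinear_def alternating_def unit_form_def)
  next
    case (Suc n)
    then show ?case
      using assms by (simp add: multilinear_shuffle_prod alternating_shuffle_prod
          multilinear_two_form alternating_two_form)
  qed
  then show "multilinear (cosymplectic_volume \<alpha> \<omega> n)" "alternating (cosymplectic_volume \<alpha> \<omega> n)"
    unfolding cosymplectic_volume_def
    using assms(1) by (simp_all add: multilinear_shuffle_prod alternating_shuffle_prod
          multilinear_covector alternating_covector)
qed

lemma basis_extending:
  assumes "independent S" "S \<subseteq> J"
  obtains C where "finite C" "S \<subseteq> C" "independent C" "span C = J" "dim J = card C"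
proof -
  obtain B where B: "finite B" "span B = J" using finitely_spanned by blast
  obtain C where C: "S \<subseteq> C" "C \<subseteq> J" "independent C" "J \<subseteq> span C"
    using maximal_independent_subset_extend[OF assms(2,1)] by blast
  have "finite C" using independent_span_bound[of B C] B C by blast
  moreover have span: "span C = J"
    using C subspace_J by (simp add: span_minimal subset_antisym)
  moreover have "dim J = card C" using dim_unique[OF C(2,4,3) refl] .
  ultimately show thesis using that C by blast
qed

lemma dim_strict_mono:
  assumes "subspace U" "subspace V" "U \<subset> V" "V \<subseteq> J"
  shows "dim U < dim V"
proof -
  obtain B where B: "B \<subseteq> U" "independent B" "U \<subseteq> span B"
    using maximal_independent_subset by blast
  obtain v where v: "v \<in> V" "v \<notin> U" using assms(3) by blast
  have "span B = U" using B assms(1) by (simp add: span_minimal subset_antisym)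
  with v B have indep: "independent (insert v B)" by (simp add: independent_insertI)
  have sub: "insert v B \<subseteq> V" using v B assms(3) by blast
  obtain C where C: "insert v B \<subseteq> C" "C \<subseteq> V" "independent C" "V \<subseteq> span C"
    using maximal_independent_subset_extend[OF sub indep] by blast
  obtain D where "finite D" "span D = J" using finitely_spanned by blast
  then have "finite C" using independent_span_bound[of D C] C assms(4) by blast
  moreover have "v \<notin> B" using v B by blast
  ultimately have "card B < card C"
    using C(1) card_mono[of C "insert v B"] finite_subset[of B C] by simp
  moreover have "dim U = card B" "dim V = card C"
    using dim_unique[OF B(1,3,2) refl] dim_unique[OF C(2,4,3) refl] by auto
  ultimately show ?thesis by simp
qed

end

section \<open>Jacobi-Jordan algebras act by simultaneously nilpotent operators\<close>

context jj_algebra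
begin

sublocale finite_dim_subspace scale J
  by unfold_locales (rule finite_dim)

lemma mult_closed: "x \<in> J \<Longrightarrow> y \<in> J \<Longrightarrow> mult x y \<in> J"
  using mult_bilinear unfolding bilinear_map_on_def linear_map_on_def by blast

lemma mult_add_right: "x \<in> J \<Longrightarrow> y \<in> J \<Longrightarrow> z \<in> J \<Longrightarrow> mult x (y + z) = mult x y + mult x z"
  using mult_bilinear unfolding bilinear_map_on_def linear_map_on_def by blast

lemma mult_add_left: "x \<in> J \<Longrightarrow> y \<in> J \<Longrightarrow> z \<in> J \<Longrightarrow> mult (x + y) z = mult x z + mult y z"
  using mult_bilinear unfolding bilinear_map_on_def linear_map_on_def by blast

lemma mult_scale_right: "x \<in> J \<Longrightarrow> y \<in> J \<Longrightarrow> mult x (scale c y) = scale c (mult x y)"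
  using mult_bilinear unfolding bilinear_map_on_def linear_map_on_def by blast

lemma mult_scale_left: "x \<in> J \<Longrightarrow> y \<in> J \<Longrightarrow> mult (scale c x) y = scale c (mult x y)"
  using mult_bilinear unfolding bilinear_map_on_def linear_map_on_def by blast

lemmas J_closed = subspace_0[OF subspace_J] subspace_add[OF subspace_J]
  subspace_scale[OF subspace_J] subspace_diff[OF subspace_J] subspace_neg[OF subspace_J]

lemma mult_0_left: "x \<in> J \<Longrightarrow> mult 0 x = 0"
  using mult_scale_left[of x x 0] by simp

lemma mult_0_right: "x \<in> J \<Longrightarrow> mult x 0 = 0"
  using mult_scale_right[of x x 0] by simp

lemma mult_minus_right: "x \<in> J \<Longrightarrow> y \<in> J \<Longrightarrow> mult x (- y) = - mult x y"
  using mult_scale_right[of x y "- 1"] by simp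

lemma mult_mult:
  assumes "x \<in> J" "y \<in> J" "z \<in> J"
  shows "mult (mult x y) z = - mult x (mult y z) - mult y (mult x z)"
proof -
  have "mult x (mult y z) + mult y (mult x z) + mult (mult x y) z = 0"
    using jacobi[OF assms] assms by (simp add: mult_commute mult_closed)
  then show ?thesis
    by (metis add.commute add_diff_cancel_left' diff_0 diff_diff_eq diff_minus_eq_add)
qed

lemma square_mult:
  assumes "x \<in> J" "z \<in> J"
  shows "mult (mult x x) z = - scale 2 (mult x (mult x z))"
proof -
  have "scale 2 v = v + v" for v
    using scale_left_distrib[of 1 1 v] by simp
  then show ?thesis using mult_mult[OF assms(1,1,2)] by simp
qed

lemma cube_eq_0:
  assumes "(3::'k) \<noteq> 0" "x \<in> J"
  shows "mult x (mult x x) = 0"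
proof -
  have "scale 3 v = v + v + v" for v
    using scale_left_distrib[of 2 1 v] scale_left_distrib[of 1 1 v] by simp
  then have "scale 3 (mult x (mult x x)) = 0"
    using jacobi[OF assms(2,2,2)] by simp
  then show ?thesis using assms(1) by simp
qed

text \<open>
  Expanding \<open>(x \<cdot> x\<^sup>2) \<cdot> z = 0\<close> with the Jacobi identity, where \<open>x\<^sup>2\<close> itself acts as
  \<open>-2\<close> times the square of \<open>x\<close>, leaves \<open>4 x(x(xz)) = 0\<close>.
\<close>

lemma mult_cubed_eq_0:
  assumes ch: "(2::'k) \<noteq> 0" "(3::'k) \<noteq> 0" and "x \<in> J" "z \<in> J"
  shows "mult x (mult x (mult x z)) = 0"
proof -
  let ?t = "mult x (mult x (mult x z))"
  note in_J = mult_closed assms(3,4) J_closed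
  have "0 = mult (mult x (mult x x)) z"
    using cube_eq_0[OF ch(2) assms(3)] assms by (simp add: mult_0_left)
  also have "\<dots> = - mult x (mult (mult x x) z) - mult (mult x x) (mult x z)"
    by (rule mult_mult) (simp_all add: in_J)
  also have "mult x (mult (mult x x) z) = - scale 2 ?t"
    by (simp add: square_mult mult_minus_right mult_scale_right in_J)
  also have "mult (mult x x) (mult x z) = - scale 2 ?t"
    by (simp add: square_mult in_J)
  also have "- (- scale 2 ?t) - (- scale 2 ?t) = scale (2 * 2) ?t"
    using scale_left_distrib[of 2 2 ?t] by simp
  finally have "scale (2 * 2) ?t = 0" by (rule sym)
  moreover have "(2 * 2 :: 'k) \<noteq> 0" using ch(1) by (metis mult_eq_0_iff)
  ultimately show ?thesis by (metis scale_eq_0_iff)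
qed

text \<open>
  The analogue of Engel's theorem, proved as for Lie algebras: a maximal proper subalgebra \<open>N\<close> of
  \<open>M\<close> acts on \<open>M / N\<close>, so some \<open>s\<close> outside \<open>N\<close> satisfies \<open>N s \<subseteq> N\<close>. A new point compared with
  the Lie case is that \<open>s\<^sup>2\<close> need not lie in \<open>N\<close>; then \<open>s\<^sup>2\<close> takes the place of \<open>s\<close>, because
  its square vanishes. Hence \<open>M\<close> is spanned by \<open>N\<close> and \<open>s\<close>. The vectors of \<open>V\<close> that \<open>N\<close> moves
  into \<open>U\<close> are stable under \<open>s\<close>, whose cube acts as zero. Stating this for sections \<open>V / U\<close>
  lets one induction serve both for \<open>M / N\<close> and for \<open>V / U\<close>.
\<close>

lemma common_annihilated_vector:
  assumes ch: "(2::'k) \<noteq> 0" "(3::'k) \<noteq> 0"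
    and "subspace M" "M \<subseteq> J" "\<And>x y. x \<in> M \<Longrightarrow> y \<in> M \<Longrightarrow> mult x y \<in> M"
    and "subspace U" "subspace V" "U \<subset> V" "V \<subseteq> J"
    and "\<And>m v. m \<in> M \<Longrightarrow> v \<in> V \<Longrightarrow> mult m v \<in> V"
    and "\<And>m u. m \<in> M \<Longrightarrow> u \<in> U \<Longrightarrow> mult m u \<in> U"
  obtains v where "v \<in> V" "v \<notin> U" "\<And>m. m \<in> M \<Longrightarrow> mult m v \<in> U"
proof -
  have "\<exists>v. v \<in> V \<and> v \<notin> U \<and> (\<forall>m\<in>M. mult m v \<in> U)"
    using assms(3-)
  proof (induction "dim M" arbitrary: M U V rule: less_induct)
    case less
    note M = less.prems(1-3) and UV = less.prems(4-7)
      and stable = less.prems(8,9)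
    show ?case
    proof (cases "M = {0}")
      case True
      obtain v where "v \<in> V" "v \<notin> U" using UV by blast
      moreover from this have "mult 0 v = 0" using UV mult_0_left by blast
      ultimately show ?thesis
        using True UV(1) by (auto simp: subspace_0 intro!: exI[of _ v])
    next
      case False
      let ?proper = "\<lambda>N. subspace N \<and> N \<subset> M \<and> (\<forall>x\<in>N. \<forall>y\<in>N. mult x y \<in> N)"
      have "{0} \<subset> M" using False M(1) by (auto simp: subspace_0)
      then have "?proper {0}" using mult_0_left[of 0] by (simp add: J_closed)
      moreover have "\<forall>N. ?proper N \<longrightarrow> dim N < dim M"
        using dim_strict_mono M(1,2) by blast
      ultimately have "\<exists>N. ?proper N \<and> (\<forall>N'. ?proper N' \<longrightarrow> dim N' \<le> dim N)"
        by (rule ex_has_greatest_nat[where P = ?proper and f = dim])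
      then obtain N where N: "?proper N" and max: "\<And>N'. ?proper N' \<Longrightarrow> dim N' \<le> dim N"
        by (elim exE conjE) blast
      have NJ: "N \<subseteq> J" and NM: "N \<subseteq> M" and subN: "subspace N"
        and Nmult: "\<And>x y. x \<in> N \<Longrightarrow> y \<in> N \<Longrightarrow> mult x y \<in> N"
        using N M(2) by auto
      have smaller: "dim N < dim M" using dim_strict_mono N M(1,2) by blast
      have "\<exists>s. s \<in> M \<and> s \<notin> N \<and> (\<forall>n\<in>N. mult n s \<in> N)"
        by (rule less.hyps[OF smaller subN NJ Nmult subN M(1) _ M(2)])
          (use N NM M(3) Nmult in auto)
      then obtain s0 where s0: "s0 \<in> M" "s0 \<notin> N" "\<And>n. n \<in> N \<Longrightarrow> mult n s0 \<in> N" by blast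
      obtain s where s: "s \<in> M" "s \<notin> N" "\<And>n. n \<in> N \<Longrightarrow> mult n s \<in> N" "mult s s \<in> N"
      proof (cases "mult s0 s0 \<in> N")
        case True
        then show thesis using that s0 by blast
      next
        case False
        have s0J: "s0 \<in> J" using s0 M(2) by blast
        have "mult n (mult s0 s0) \<in> N" if n: "n \<in> N" for n
        proof -
          have nJ: "n \<in> J" using n NJ by blast
          have "mult s0 n \<in> N" using s0(3)[OF n] mult_commute[OF s0J nJ] by simp
          then have "mult s0 (mult s0 n) \<in> N"
            using s0(3) mult_commute[OF s0J] NJ by (metis subsetD)
          then show ?thesis
            using square_mult[OF s0J nJ] mult_commute[OF nJ mult_closed[OF s0J s0J]] subN
            by (simp add: subspace_neg subspace_scale)
        qed
        moreover have "mult (mult s0 s0) (mult s0 s0) = 0"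
          using square_mult[OF s0J mult_closed[OF s0J s0J]] cube_eq_0[OF ch(2) s0J] s0J
          by (simp add: mult_0_right)
        ultimately show thesis
          using that[of "mult s0 s0"] False M(3)[OF s0(1,1)] subN by (simp add: subspace_0)
      qed
      have sJ: "s \<in> J" using s M(2) by blast
      let ?N' = "{n + scale c s | n c. n \<in> N}"
      have sub': "subspace ?N'"
        unfolding subspace_def
      proof (intro conjI ballI allI)
        show "0 \<in> ?N'" using subN by (auto intro!: exI[of _ 0] simp: subspace_0)
      next
        fix x y assume "x \<in> ?N'" "y \<in> ?N'"
        then obtain n c n' c' where "x = n + scale c s" "y = n' + scale c' s" "n \<in> N" "n' \<in> N"
          by blast
        then have "x + y = (n + n') + scale (c + c') s" "n + n' \<in> N"
          using subN by (auto simp: scale_left_distrib subspace_add)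
        then show "x + y \<in> ?N'" by blast
      next
        fix k x assume "x \<in> ?N'"
        then obtain n c where "x = n + scale c s" "n \<in> N" by blast
        then have "scale k x = scale k n + scale (k * c) s" "scale k n \<in> N"
          using subN by (auto simp: scale_right_distrib subspace_scale)
        then show "scale k x \<in> ?N'" by blast
      qed
      have NN': "N \<subseteq> ?N'" by (force intro: exI[of _ 0])
      have "s = 0 + scale 1 s" "0 \<in> N" using subN by (auto simp: subspace_0)
      then have sN': "s \<in> ?N'" by blast
      have N'M: "?N' \<subseteq> M" using NM s(1) M(1) by (auto simp: subspace_add subspace_scale)
      have "mult x y \<in> ?N'" if xy: "x \<in> ?N'" "y \<in> ?N'" for x y
      proof -
        obtain n c n' c' where e: "x = n + scale c s" "y = n' + scale c' s" "n \<in> N" "n' \<in> N"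
          using xy by blast
        then have J: "n \<in> J" "n' \<in> J" using NJ by auto
        have "mult x y = mult n n' + scale c' (mult n s)
            + (scale c (mult n' s) + scale c (scale c' (mult s s)))"
          unfolding e(1,2) using J sJ mult_commute[OF J(2) sJ]
          by (simp add: mult_add_left mult_add_right mult_scale_left mult_scale_right J_closed
              mult_closed scale_right_distrib)
        also have "\<dots> \<in> N"
          using e s subN Nmult by (intro subspace_add subspace_scale) auto
        finally show ?thesis using NN' by blast
      qed
      moreover have "\<not> dim ?N' \<le> dim N"
      proof -
        have "N \<subset> ?N'" using NN' sN' s(2) by blast
        moreover have "?N' \<subseteq> J" using N'M M(2) by (rule subset_trans)
        ultimately show ?thesis using dim_strict_mono[OF subN sub'] by simp
      qed
      ultimately have M_eq: "M = ?N'"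
        using max[of ?N'] sub' N'M by blast
      have "\<exists>v. v \<in> V \<and> v \<notin> U \<and> (\<forall>n\<in>N. mult n v \<in> U)"
        by (rule less.hyps[OF smaller subN NJ Nmult UV]) (use NM stable in auto)
      then obtain w where w: "w \<in> V" "w \<notin> U" "\<forall>n\<in>N. mult n w \<in> U" by blast
      have step: "mult s v \<in> V \<and> (\<forall>n\<in>N. mult n (mult s v) \<in> U)"
        if v: "v \<in> V" "\<forall>n\<in>N. mult n v \<in> U" for v
      proof (intro conjI ballI)
        show "mult s v \<in> V" using stable(1) s(1) v(1) by blast
        fix n assume n: "n \<in> N"
        have J: "n \<in> J" "v \<in> J" using n NJ v UV by auto
        have "mult n (mult s v) = - mult (mult n s) v - mult s (mult n v)"
          using mult_mult[OF J(1) sJ J(2)] by simp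
        moreover have "mult (mult n s) v \<in> U" "mult s (mult n v) \<in> U"
          using v n s stable(2) by blast+
        ultimately show "mult n (mult s v) \<in> U"
          using UV(1) by (simp add: subspace_diff subspace_neg)
      qed
      \<comment> \<open>The last of \<open>w\<close>, \<open>s w\<close>, \<open>s (s w)\<close> outside \<open>U\<close> is the vector sought.\<close>
      have "mult s (mult s (mult s w)) \<in> U"
        using mult_cubed_eq_0[OF ch sJ, of w] w(1) UV by (auto simp: subspace_0)
      then obtain v where v: "v \<in> V" "v \<notin> U" "\<forall>n\<in>N. mult n v \<in> U" "mult s v \<in> U"
        using w step[OF w(1,3)] step[of "mult s w"] by blast
      have "mult m v \<in> U" if m: "m \<in> M" for m
      proof -
        obtain n c where e: "m = n + scale c s" "n \<in> N" using m M_eq by blast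
        have "v \<in> J" "n \<in> J" using v(1) UV e(2) NJ by auto
        then have "mult m v = mult n v + scale c (mult s v)"
          using e(1) sJ by (simp add: mult_add_left mult_scale_left J_closed)
        then show ?thesis using v e(2) UV(1) by (simp add: subspace_add subspace_scale)
      qed
      then show ?thesis using v by blast
    qed
  qed
  then show thesis using that by blast
qed

end

section \<open>The annihilated vector and its dual\<close>

context cosymplectic_jj_algebra
begin

lemma alpha_add: "x \<in> J \<Longrightarrow> y \<in> J \<Longrightarrow> \<alpha> (x + y) = \<alpha> x + \<alpha> y"
  and alpha_scale: "x \<in> J \<Longrightarrow> \<alpha> (scale c x) = c * \<alpha> x"
  using alpha_linear unfolding linear_map_on_def by blast+

lemma omega_add_left: "x \<in> J \<Longrightarrow> y \<in> J \<Longrightarrow> z \<in> J \<Longrightarrow> \<omega> (x + y) z = \<omega> x z + \<omega> y z"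
  and omega_add_right: "x \<in> J \<Longrightarrow> y \<in> J \<Longrightarrow> z \<in> J \<Longrightarrow> \<omega> z (x + y) = \<omega> z x + \<omega> z y"
  and omega_scale_left: "x \<in> J \<Longrightarrow> z \<in> J \<Longrightarrow> \<omega> (scale c x) z = c * \<omega> x z"
  and omega_scale_right: "x \<in> J \<Longrightarrow> z \<in> J \<Longrightarrow> \<omega> z (scale c x) = c * \<omega> z x"
  using omega_bilinear unfolding bilinear_map_on_def linear_map_on_def by blast+

lemma alpha_0: "\<alpha> 0 = 0"
  using alpha_scale[of 0 0] by (simp add: J_closed)

lemma omega_0: "z \<in> J \<Longrightarrow> \<omega> 0 z = 0" "z \<in> J \<Longrightarrow> \<omega> z 0 = 0"
  using omega_scale_left[of 0 z 0] omega_scale_right[of 0 z 0] by (simp_all add: J_closed)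

lemma alpha_diff: "x \<in> J \<Longrightarrow> y \<in> J \<Longrightarrow> \<alpha> (x - y) = \<alpha> x - \<alpha> y"
  using alpha_add[of "x - y" y] by (simp add: J_closed)

lemma omega_diff_left: "x \<in> J \<Longrightarrow> y \<in> J \<Longrightarrow> z \<in> J \<Longrightarrow> \<omega> (x - y) z = \<omega> x z - \<omega> y z"
  and omega_diff_right: "x \<in> J \<Longrightarrow> y \<in> J \<Longrightarrow> z \<in> J \<Longrightarrow> \<omega> z (x - y) = \<omega> z x - \<omega> z y"
  using omega_add_left[of "x - y" y z] omega_add_right[of "x - y" y z] by (simp_all add: J_closed)

lemma omega_self:
  assumes "(2::'k) \<noteq> 0" "x \<in> J"
  shows "\<omega> x x = 0"
proof -
  have "2 * \<omega> x x = 0"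
    using omega_skew[OF assms(2,2)] by (metis mult_2 add.right_inverse)
  then show ?thesis using assms(1) by simp
qed

lemma volume_nonzero_on_basis:
  assumes ch: "(2::'k) \<noteq> 0" and n: "dim J = 2 * n + 1"
    and C: "finite C" "span C = J" "card C = dim J" and ps: "distinct ps" "set ps \<subseteq> C"
  obtains zs where "set zs \<subseteq> C - set ps" "cosymplectic_volume \<alpha> \<omega> n (ps @ zs) \<noteq> 0"
proof -
  note goal = that
  obtain n' where n': "dim J = 2 * n' + 1" "nonzero_form_on (2 * n' + 1) J
      (wedge 1 (n' * 2) (one_form \<alpha>) (wedge_power 2 (two_form \<omega>) n'))"
    using nondegenerate by blast
  then have "n' = n" using n by simp
  then have "\<exists>vs. set vs \<subseteq> J \<and> cosymplectic_volume \<alpha> \<omega> n vs \<noteq> 0"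
    using n'(2) by (simp only: nonzero_form_on_iff_cosymplectic_volume)
  then obtain vs where vs: "set vs \<subseteq> J" "cosymplectic_volume \<alpha> \<omega> n vs \<noteq> 0"
    by blast
  show thesis
  proof (rule top_form_nonzero_on_basis[where \<eta> = "cosymplectic_volume \<alpha> \<omega> n",
        OF _ _ _ vs(2,1) C(1,2) ps])
    show thesis if "set zs \<subseteq> C - set ps" "cosymplectic_volume \<alpha> \<omega> n (ps @ zs) \<noteq> 0" for zs
      by (rule goal[OF that])
    show "multilinear (cosymplectic_volume \<alpha> \<omega> n)" "alternating (cosymplectic_volume \<alpha> \<omega> n)"
      using exterior_cosymplectic_volume[OF alpha_linear omega_bilinear omega_self[OF ch]] by blast+
    show "length ws = card C" if "cosymplectic_volume \<alpha> \<omega> n ws \<noteq> 0" for ws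
      using that C(3) n
      by (simp add: cosymplectic_volume_eq homogeneous_part_def split: if_splits)
  qed
qed

text \<open>
  If \<open>\<omega>(e, -)\<close> were zero, the volume form would vanish on every basis starting with \<open>e\<close>.
\<close>

lemma omega_nondegenerate_on_kernel:
  assumes ch: "(2::'k) \<noteq> 0" and e: "e \<in> J" "e \<noteq> 0" "\<alpha> e = 0"
  obtains d where "d \<in> J" "\<omega> d e = 1"
proof -
  obtain n where n: "dim J = 2 * n + 1" using nondegenerate by blast
  have "independent {e}" using e(2) by simp
  then obtain C where C: "finite C" "{e} \<subseteq> C" "span C = J" "dim J = card C"
    using basis_extending[of "{e}"] e(1) by auto
  obtain zs where zs: "set zs \<subseteq> C - {e}" "cosymplectic_volume \<alpha> \<omega> n (e # zs) \<noteq> 0"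
    using volume_nonzero_on_basis[OF ch n C(1,3) C(4)[symmetric], of "[e]"] C(2) by auto
  then obtain x where x: "x \<in> set zs" "\<omega> e x \<noteq> 0"
    using cosymplectic_volume_radical_eq_0[of \<alpha> e zs \<omega> n] e(3) by blast
  then have xJ: "x \<in> J" using zs(1) C(3) span_superset by blast
  have "\<omega> x e \<noteq> 0" using x(2) omega_skew[OF xJ e(1)] by simp
  then have "\<omega> (scale (inverse (\<omega> x e)) x) e = 1"
    using xJ e(1) by (simp add: omega_scale_left)
  moreover have "scale (inverse (\<omega> x e)) x \<in> J" using xJ by (simp add: J_closed)
  ultimately show thesis using that by blast
qed

text \<open>
  The kernel of \<open>\<alpha>\<close> is an ideal because it contains all products. It is nonzero as soon as there
  are two independent vectors; dimension 1 is the only odd dimension without these.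
\<close>

lemma annihilated_kernel_vector:
  assumes ch: "(2::'k) \<noteq> 0" "(3::'k) \<noteq> 0" and dim: "dim J \<noteq> 1"
  obtains e where "e \<in> J" "e \<noteq> 0" "\<alpha> e = 0" "\<And>x. x \<in> J \<Longrightarrow> mult x e = 0"
proof -
  let ?K = "{x \<in> J. \<alpha> x = 0}"
  have K: "subspace ?K"
    unfolding subspace_def by (simp add: J_closed alpha_0 alpha_add alpha_scale)
  have "\<exists>x. x \<in> ?K \<and> x \<noteq> 0"
  proof (rule ccontr)
    assume no: "\<not> ?thesis"
    obtain C where C: "finite C" "independent C" "span C = J" "dim J = card C"
      using basis_extending[of "{}"] independent_empty by blast
    obtain n where "dim J = 2 * n + 1" using nondegenerate by blast
    then have "2 \<le> card C" using dim C(4) by simp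
    then have "\<not> card C \<le> Suc 0" by simp
    then obtain u v where uv: "u \<in> C" "v \<in> C" "u \<noteq> v"
      unfolding card_le_Suc0_iff_eq[OF C(1)] by blast
    then have uvJ: "u \<in> J" "v \<in> J" using C(3) span_superset by blast+
    have "u \<noteq> 0" using uv(1) C(2) dependent_zero by blast
    then have au: "\<alpha> u \<noteq> 0" using no uvJ by blast
    have "v - scale (\<alpha> v / \<alpha> u) u \<in> ?K"
      using uvJ au by (simp add: J_closed alpha_diff alpha_scale)
    then have "v = scale (\<alpha> v / \<alpha> u) u" using no by fastforce
    moreover have "u \<in> C - {v}" using uv by blast
    ultimately have "v \<in> span (C - {v})" using span_base span_scale by metis
    then show False using C(2) uv(2) dependent_def by blast
  qed
  then have proper: "{0} \<subset> ?K" by (auto simp: J_closed alpha_0)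
  obtain e where "e \<in> ?K" "e \<notin> {0}" "\<And>x. x \<in> J \<Longrightarrow> mult x e \<in> {0}"
    by (rule common_annihilated_vector[OF ch subspace_J order_refl mult_closed
          subspace_single_0 K proper])
      (auto simp: mult_closed alpha_mult mult_0_right)
  then show thesis using that by blast
qed

end

section \<open>Reduction by the annihilated vector\<close>

locale cosymplectic_reduction = cosymplectic_jj_algebra scale J mult \<alpha> \<omega>
  for scale :: "'k::field \<Rightarrow> 'v::ab_group_add \<Rightarrow> 'v"
    and J :: "'v set" and mult :: "'v \<Rightarrow> 'v \<Rightarrow> 'v"
    and \<alpha> :: "'v \<Rightarrow> 'k" and \<omega> :: "'v \<Rightarrow> 'v \<Rightarrow> 'k" +
  fixes d e :: 'v
  assumes two: "(2::'k) \<noteq> 0" and three: "(3::'k) \<noteq> 0" and dim_ne_1: "dim J \<noteq> 1"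
    and d_in: "d \<in> J" and e_in: "e \<in> J" and omega_de: "\<omega> d e = 1"
    and alpha_e: "\<alpha> e = 0" and mult_e: "x \<in> J \<Longrightarrow> mult x e = 0"
begin

definition perp :: "'v set" where
  "perp = {x \<in> J. \<omega> d x = 0 \<and> \<omega> e x = 0}"

text \<open>
  The projection along \<open>d\<close> and \<open>e\<close>, whose coefficients are read off from \<open>\<omega>(d, e) = 1\<close>.
\<close>

definition proj :: "'v \<Rightarrow> 'v" where
  "proj x = x - scale (\<omega> x e) d - scale (\<omega> d x) e"

definition perp_mult :: "'v \<Rightarrow> 'v \<Rightarrow> 'v" where
  "perp_mult x y = proj (mult x y)"

lemmas in_J = J_closed mult_closed d_in e_in
lemmas omega_lin = omega_add_left omega_add_right omega_scale_left omega_scale_right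
  omega_diff_left omega_diff_right omega_0

lemma perp_J: "x \<in> perp \<Longrightarrow> x \<in> J"
  by (simp add: perp_def)

lemma omega_ed: "\<omega> e d = - 1"
  using omega_skew[OF e_in d_in] omega_de by simp

lemma perp_omega:
  assumes "x \<in> perp"
  shows "\<omega> d x = 0" "\<omega> e x = 0" "\<omega> x d = 0" "\<omega> x e = 0"
  using assms omega_skew[of x d] omega_skew[of x e] d_in e_in by (auto simp: perp_def)

lemma subspace_perp: "subspace perp"
  unfolding subspace_def perp_def by (simp add: omega_lin in_J)

lemmas perp_closed = subspace_add[OF subspace_perp] subspace_scale[OF subspace_perp]
  subspace_0[OF subspace_perp]

lemma proj_in_perp:
  assumes "x \<in> J" shows "proj x \<in> perp"
  using assms omega_skew[OF e_in assms]
  by (simp add: perp_def proj_def in_J omega_lin omega_self[OF two] omega_de omega_ed)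

lemma proj_add: "x \<in> J \<Longrightarrow> y \<in> J \<Longrightarrow> proj (x + y) = proj x + proj y"
  by (simp add: proj_def in_J omega_lin scale_left_distrib algebra_simps)

lemma proj_scale: "x \<in> J \<Longrightarrow> proj (scale c x) = scale c (proj x)"
  by (simp add: proj_def in_J omega_lin scale_right_diff_distrib)

lemma proj_perp: "x \<in> perp \<Longrightarrow> proj x = x"
  by (simp add: proj_def perp_omega)

lemma proj_0: "proj 0 = 0"
  by (simp add: proj_perp perp_closed)

lemma mult_e_left: "x \<in> J \<Longrightarrow> mult e x = 0"
  using mult_e mult_commute[OF e_in] by simp

text \<open>Closedness of \<open>\<omega>\<close> on \<open>x, y, e\<close>: the two products with \<open>e\<close> vanish.\<close>

lemma omega_mult_e:
  assumes "x \<in> J" "y \<in> J"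
  shows "\<omega> (mult x y) e = 0"
  using omega_closed[OF assms e_in] assms by (simp add: mult_e mult_e_left omega_0)

lemma mult_decompose:
  assumes "x \<in> J" "y \<in> J"
  shows "mult x y = proj (mult x y) + scale (\<omega> d (mult x y)) e"
  by (simp add: proj_def omega_mult_e[OF assms])

text \<open>Closedness of \<open>\<omega>\<close> on \<open>d, d, d\<close> reads \<open>3 \<omega>(d \<cdot> d, d) = 0\<close>.\<close>

lemma square_d_in_perp: "mult d d \<in> perp"
proof -
  have "3 * \<omega> (mult d d) d = 0"
    using omega_closed[OF d_in d_in d_in] by simp
  then have "\<omega> (mult d d) d = 0" using three by simp
  then show ?thesis
    using omega_skew[of "mult d d" d] omega_skew[of e "mult d d"] omega_mult_e[OF d_in d_in]
    by (simp add: perp_def in_J)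
qed

lemma omega_proj:
  assumes "x \<in> J" "y \<in> J" "z \<in> perp"
  shows "\<omega> (proj (mult x y)) z = \<omega> (mult x y) z"
  using assms perp_J[OF assms(3)] perp_omega[OF assms(3)]
  by (simp add: proj_def in_J omega_lin)

lemma mult_proj:
  assumes "x \<in> J" "y \<in> J" "z \<in> J"
  shows "mult z (proj (mult x y)) = mult z (mult x y)"
proof -
  have "mult z (mult x y) = mult z (proj (mult x y) + scale (\<omega> d (mult x y)) e)"
    using mult_decompose[OF assms(1,2)] by simp
  also have "\<dots> = mult z (proj (mult x y))"
    using assms by (simp add: mult_add_right mult_scale_right mult_e in_J perp_J proj_in_perp)
  finally show ?thesis by simp
qed

lemma basis_perp:
  obtains C where "finite C" "independent C" "span C = perp"
proof -
  obtain C where C: "C \<subseteq> perp" "independent C" "perp \<subseteq> span C"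
    using maximal_independent_subset by blast
  obtain D where D: "finite D" "span D = J" using finitely_spanned by blast
  have "C \<subseteq> span D" using C(1) perp_J D(2) by blast
  then have "finite C" using independent_span_bound[OF D(1) C(2)] by blast
  moreover have "span C = perp" using C subspace_perp by (simp add: span_minimal subset_antisym)
  ultimately show thesis using that C by blast
qed

lemma jj_algebra_perp: "jj_algebra scale perp perp_mult"
proof
  show "\<exists>B. finite B \<and> B \<subseteq> perp \<and> span B = perp"
    using basis_perp span_superset by metis
  show "bilinear_map_on scale scale perp perp perp_mult"
    unfolding bilinear_map_on_def linear_map_on_def perp_mult_def
    by (auto simp: proj_in_perp perp_J in_J mult_add_left mult_add_right mult_scale_left
        mult_scale_right proj_add proj_scale)
next
  fix x y assume "x \<in> perp" "y \<in> perp"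
  then show "perp_mult x y = perp_mult y x"
    by (simp add: perp_mult_def mult_commute perp_J)
next
  fix x y z assume "x \<in> perp" "y \<in> perp" "z \<in> perp"
  then have J: "x \<in> J" "y \<in> J" "z \<in> J" by (simp_all add: perp_J)
  then have "perp_mult x (perp_mult y z) + perp_mult y (perp_mult z x) + perp_mult z (perp_mult x y)
      = proj (mult x (mult y z) + mult y (mult z x) + mult z (mult x y))"
    by (simp add: perp_mult_def mult_proj proj_add in_J)
  then show "perp_mult x (perp_mult y z) + perp_mult y (perp_mult z x)
      + perp_mult z (perp_mult x y) = 0"
    using jacobi[OF J] proj_0 by simp
qed

text \<open>
  Adjoining \<open>e\<close> and \<open>d\<close> to a basis of the complement gives a basis of the whole space. The volume
  form is nonzero on it, and on a list starting with \<open>e\<close> and \<open>d\<close> it is a multiple of the volume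
  form of the complement, one degree of \<open>\<omega>\<close> lower.
\<close>

lemma nondegenerate_perp:
  "\<exists>n. dim perp = 2 * n + 1 \<and> nonzero_form_on (2 * n + 1) perp
     (wedge 1 (n * 2) (one_form \<alpha>) (wedge_power 2 (two_form \<omega>) n))"
proof -
  obtain C where C: "finite C" "independent C" "span C = perp" by (rule basis_perp)
  have Cperp: "C \<subseteq> perp" using C(3) span_superset by blast
  have "e \<notin> perp" using perp_omega(1)[of e] omega_de by auto
  then have eC: "e \<notin> span C" using C(3) by simp
  have d_notin: "d \<notin> span (insert e C)"
  proof
    assume "d \<in> span (insert e C)"
    then obtain k where "d - scale k e \<in> perp" using C(3) span_insert by auto
    then have "\<omega> e (d - scale k e) = 0" by (rule perp_omega)
    then show False by (simp add: omega_lin in_J omega_ed omega_self[OF two])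
  qed
  let ?B = "insert d (insert e C)"
  have indep: "independent ?B"
    using C(2) eC d_notin by (simp add: independent_insertI)
  have "x \<in> span ?B" if x: "x \<in> J" for x
  proof -
    have "proj x \<in> span ?B" using proj_in_perp[OF x] C(3) span_mono[of C ?B] by blast
    then have "proj x + scale (\<omega> x e) d + scale (\<omega> d x) e \<in> span ?B"
      by (intro span_add span_scale) (auto intro: span_base)
    then show ?thesis by (simp add: proj_def)
  qed
  moreover have BJ: "?B \<subseteq> J" using Cperp perp_J in_J by blast
  ultimately have span: "span ?B = J"
    using subspace_J by (simp add: span_minimal subset_antisym subsetI)
  have "dim J = card ?B"
    using dim_unique[OF BJ _ indep refl] span by simp
  moreover have neq: "d \<noteq> e" "e \<notin> C" "d \<notin> C"
    using eC d_notin span_base[of _ "insert e C"] span_base[of _ C] by auto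
  ultimately have card: "dim J = card C + 2" "card ?B = dim J" using C(1) by simp_all
  obtain m where m: "dim J = 2 * m + 1" using nondegenerate by blast
  then obtain n where n: "m = Suc n" using dim_ne_1 by (cases m) auto
  obtain zs where zs: "set zs \<subseteq> ?B - set [e, d]"
    "cosymplectic_volume \<alpha> \<omega> (Suc n) ([e, d] @ zs) \<noteq> 0"
    by (rule volume_nonzero_on_basis[OF two m[unfolded n] _ span card(2), of "[e, d]"])
      (use C(1) neq in auto)
  then have zsperp: "set zs \<subseteq> perp" using Cperp by auto
  have "cosymplectic_volume \<alpha> \<omega> (Suc n) (e # d # zs)
      = of_nat (Suc n) * \<omega> e d * cosymplectic_volume \<alpha> \<omega> n zs"
    using zsperp by (intro cosymplectic_volume_hyperbolic_plane alpha_e perp_omega) auto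
  then have "cosymplectic_volume \<alpha> \<omega> n zs \<noteq> 0" using zs(2) by auto
  moreover have "dim perp = card C"
    using dim_unique[OF Cperp _ C(2) refl] C(3) by simp
  ultimately show ?thesis
    using card(1) m n zsperp nonzero_form_on_iff_cosymplectic_volume[of n perp \<alpha> \<omega>]
    by (intro exI[of _ n]) auto
qed

lemma cosymplectic_perp: "cosymplectic_jj_algebra scale perp perp_mult \<alpha> \<omega>"
proof (intro cosymplectic_jj_algebra.intro jj_algebra_perp cosymplectic_jj_algebra_axioms.intro)
  show "linear_form_on scale perp \<alpha>"
    using alpha_linear perp_J unfolding linear_map_on_def by blast
  show "bilinear_form_on scale perp \<omega>"
    using omega_bilinear perp_J unfolding bilinear_map_on_def linear_map_on_def by blast
  show "\<omega> x y = - \<omega> y x" if "x \<in> perp" "y \<in> perp" for x y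
    using that perp_J omega_skew by blast
  show "\<alpha> (perp_mult x y) = 0" if "x \<in> perp" "y \<in> perp" for x y
  proof -
    have J: "x \<in> J" "y \<in> J" using that perp_J by blast+
    have "\<alpha> (perp_mult x y) = \<alpha> (mult x y) - \<omega> d (mult x y) * \<alpha> e"
      using J by (simp add: perp_mult_def proj_def omega_mult_e alpha_diff alpha_scale in_J)
    then show ?thesis using J by (simp add: alpha_mult alpha_e)
  qed
  show "\<omega> (perp_mult x y) z + \<omega> (perp_mult z x) y + \<omega> (perp_mult y z) x = 0"
    if "x \<in> perp" "y \<in> perp" "z \<in> perp" for x y z
    using that by (simp add: perp_mult_def omega_proj perp_J omega_closed)
qed (rule nondegenerate_perp)

section \<open>The algebra as a double extension of its reduction\<close>

definition ext_iso :: "'k \<times> 'v \<times> 'k \<Rightarrow> 'v" where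
  "ext_iso = (\<lambda>(s, x, t). scale s d + x + scale t e)"

abbreviation ext_product :: "'k \<times> 'v \<times> 'k \<Rightarrow> 'k \<times> 'v \<times> 'k \<Rightarrow> 'k \<times> 'v \<times> 'k" where
  "ext_product \<equiv> ext_mult scale perp_mult (\<lambda>x y. \<omega> d (mult x y)) (\<lambda>x. proj (mult d x))
     (\<lambda>x. \<omega> d (mult d x)) (mult d d)"

lemma ext_iso_J: "u \<in> ext_carrier perp \<Longrightarrow> ext_iso u \<in> J"
  by (auto simp: ext_carrier_def ext_iso_def in_J perp_J)

lemma ext_iso_add: "ext_iso (u + v) = ext_iso u + ext_iso v"
  by (cases u; cases v) (simp add: ext_iso_def scale_left_distrib)

lemma ext_iso_scale: "ext_iso (ext_scale scale c u) = scale c (ext_iso u)"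
  by (cases u) (simp add: ext_iso_def ext_scale_def scale_right_distrib)

lemma bij_ext_iso: "bij_betw ext_iso (ext_carrier perp) J"
proof (rule bij_betw_byWitness[where f' = "\<lambda>v. (\<omega> v e, proj v, \<omega> d v)"])
  show "\<forall>u\<in>ext_carrier perp. (\<omega> (ext_iso u) e, proj (ext_iso u), \<omega> d (ext_iso u)) = u"
    by (auto simp: ext_carrier_def ext_iso_def proj_def omega_lin in_J perp_J perp_omega
        omega_de omega_self[OF two])
  show "\<forall>v\<in>J. ext_iso (\<omega> v e, proj v, \<omega> d v) = v"
    by (simp add: ext_iso_def proj_def)
  show "ext_iso ` ext_carrier perp \<subseteq> J" using ext_iso_J by blast
  show "(\<lambda>v. (\<omega> v e, proj v, \<omega> d v)) ` J \<subseteq> ext_carrier perp"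
    by (auto simp: ext_carrier_def proj_in_perp)
qed

lemma ext_product_closed:
  assumes "u \<in> ext_carrier perp" "v \<in> ext_carrier perp"
  shows "ext_product u v \<in> ext_carrier perp"
  using assms
  by (auto simp: ext_carrier_def ext_mult_def perp_mult_def in_J perp_J
      intro!: perp_closed proj_in_perp square_d_in_perp)

lemma ext_iso_mult:
  assumes "u \<in> ext_carrier perp" "v \<in> ext_carrier perp"
  shows "ext_iso (ext_product u v) = mult (ext_iso u) (ext_iso v)"
proof -
  obtain s x t s' x' t' where uv: "u = (s, x, t)" "v = (s', x', t')" "x \<in> perp" "x' \<in> perp"
    using assms by (auto simp: ext_carrier_def)
  then have J: "x \<in> J" "x' \<in> J" by (simp_all add: perp_J)
  let ?m = "\<lambda>a b. proj (mult a b) + scale (\<omega> d (mult a b)) e"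
  have "mult (ext_iso u) (ext_iso v)
      = scale (s * s') (mult d d) + scale s (mult d x') + scale s' (mult d x) + mult x x'"
    using J by (simp add: uv ext_iso_def mult_add_left mult_add_right mult_scale_left
        mult_scale_right mult_e mult_e_left mult_commute[of x d] in_J scale_right_distrib algebra_simps)
  also have "\<dots> = scale (s * s') (mult d d) + scale s (?m d x') + scale s' (?m d x) + ?m x x'"
    using mult_decompose[OF d_in J(2)] mult_decompose[OF d_in J(1)] mult_decompose[OF J] by simp
  also have "\<dots> = ext_iso (ext_product u v)"
    by (simp add: uv ext_iso_def ext_mult_def perp_mult_def scale_left_distrib
        scale_right_distrib algebra_simps)
  finally show ?thesis by simp
qed

text \<open>
  All laws are pulled back along the injective map \<open>ext_iso\<close>, which is linear and multiplicative.
\<close>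

lemma jj_algebra_ext: "jj_algebra (ext_scale scale) (ext_carrier perp) ext_product"
proof -
  let ?E = "ext_carrier perp :: ('k \<times> 'v \<times> 'k) set"
  interpret ext: vector_space "ext_scale scale"
    by unfold_locales
      (auto simp: ext_scale_def scale_left_distrib scale_right_distrib algebra_simps)
  have E_add: "u + v \<in> ?E" and E_scale: "ext_scale scale c u \<in> ?E"
    if "u \<in> ?E" "v \<in> ?E" for u v c
    using that by (auto simp: ext_carrier_def ext_scale_def perp_closed)
  have E_0: "0 \<in> ?E" by (simp add: ext_carrier_def zero_prod_def perp_closed)
  have eqI: "u = v" if "ext_iso u = ext_iso v" "u \<in> ?E" "v \<in> ?E" for u v
    using that bij_ext_iso unfolding bij_betw_def inj_on_def by blast
  note hom = ext_iso_mult ext_iso_add ext_iso_scale ext_iso_J ext_product_closed E_add E_scale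
  show ?thesis
  proof
    obtain C where C: "finite C" "independent C" "span C = perp" by (rule basis_perp)
    let ?B = "{(1, 0, 0), (0, 0, 1)} \<union> (\<lambda>x. (0, x, 0)) ` C"
    have subE: "ext.subspace ?E" unfolding ext.subspace_def using E_0 E_add E_scale by blast
    have BE: "?B \<subseteq> ?E"
      using C(3) span_superset[of C] by (auto simp: ext_carrier_def perp_closed)
    have mid: "(0, x, 0) \<in> ext.span ?B" if "x \<in> perp" for x
    proof -
      let ?N = "{x. (0, x, 0) \<in> ext.span ?B}"
      have "subspace ?N"
        unfolding subspace_def
      proof (intro conjI ballI allI)
        show "0 \<in> ?N" using ext.span_zero by (simp add: zero_prod_def)
      next
        fix x y assume "x \<in> ?N" "y \<in> ?N"
        then show "x + y \<in> ?N" using ext.span_add[of "(0, x, 0)" ?B "(0, y, 0)"] by simp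
      next
        fix c x assume "x \<in> ?N"
        then show "scale c x \<in> ?N"
          using ext.span_scale[of "(0, x, 0)" ?B c] by (simp add: ext_scale_def)
      qed
      moreover have "C \<subseteq> ?N" by (auto intro!: ext.span_base)
      ultimately show ?thesis using span_minimal[of C ?N] C(3) that by blast
    qed
    have "u \<in> ext.span ?B" if "u \<in> ?E" for u
    proof -
      obtain s x t where u: "u = (s, x, t)" "x \<in> perp" using \<open>u \<in> ?E\<close> by (auto simp: ext_carrier_def)
      have "(1, 0, 0) \<in> ext.span ?B" "(0, 0, 1) \<in> ext.span ?B" by (auto intro!: ext.span_base)
      then have "ext_scale scale s (1, 0, 0) + (0, x, 0) + ext_scale scale t (0, 0, 1) \<in> ext.span ?B"
        by (intro ext.span_add ext.span_scale mid u)
      then show ?thesis by (simp add: u ext_scale_def)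
    qed
    then have "ext.span ?B = ?E" using ext.span_minimal[OF BE subE] by blast
    then show "\<exists>B. finite B \<and> B \<subseteq> ?E \<and> ext.span B = ?E"
      using BE C(1) by (intro exI[of _ ?B]) auto
    show "bilinear_map_on (ext_scale scale) (ext_scale scale) ?E ?E ext_product"
      unfolding bilinear_map_on_def linear_map_on_def
      by (intro conjI ballI allI; (rule eqI)?)
        (simp_all add: hom mult_add_left mult_add_right mult_scale_left mult_scale_right)
  next
    fix u v assume "u \<in> ?E" "v \<in> ?E"
    then show "ext_product u v = ext_product v u"
      by (intro eqI) (simp_all add: hom mult_commute)
  next
    fix u v w assume "u \<in> ?E" "v \<in> ?E" "w \<in> ?E"
    moreover have "ext_iso 0 = 0" by (simp add: ext_iso_def zero_prod_def)
    ultimately show "ext_product u (ext_product v w) + ext_product v (ext_product w u)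
        + ext_product w (ext_product u v) = 0"
      by (intro eqI) (simp_all add: hom jacobi E_0)
  qed
qed

lemma double_extension:
  "cosymplectic_double_extension scale J mult \<alpha> \<omega> scale perp perp_mult \<alpha> \<omega>"
  unfolding cosymplectic_double_extension_def
proof (intro conjI exI)
  show "cosymplectic_jj_algebra scale J mult \<alpha> \<omega>" by unfold_locales
  show "cosymplectic_jj_algebra scale perp perp_mult \<alpha> \<omega>" by (rule cosymplectic_perp)
  show "jj_double_extension scale perp perp_mult (\<lambda>x y. \<omega> d (mult x y)) (\<lambda>x. proj (mult d x))
      (\<lambda>x. \<omega> d (mult d x)) (mult d d)"
    unfolding jj_double_extension_def
  proof (intro conjI jj_algebra_perp jj_algebra_ext square_d_in_perp)
    show "bilinear_form_on scale perp (\<lambda>x y. \<omega> d (mult x y))"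
      unfolding bilinear_map_on_def linear_map_on_def
      by (simp add: perp_J in_J omega_lin mult_add_left mult_add_right mult_scale_left mult_scale_right)
    show "\<forall>x\<in>perp. \<forall>y\<in>perp. \<omega> d (mult x y) = \<omega> d (mult y x)"
      by (simp add: perp_J mult_commute)
    show "linear_map_on scale scale perp perp (\<lambda>x. proj (mult d x))"
      unfolding linear_map_on_def
      by (simp add: perp_J in_J proj_in_perp mult_add_right mult_scale_right proj_add proj_scale)
    show "linear_form_on scale perp (\<lambda>x. \<omega> d (mult d x))"
      unfolding linear_map_on_def
      by (simp add: perp_J in_J mult_add_right mult_scale_right omega_lin)
  qed
  show "jj_isomorphism (ext_scale scale) (ext_carrier perp) ext_product scale J mult ext_iso"
    unfolding jj_isomorphism_def linear_map_on_def
    by (simp add: bij_ext_iso ext_iso_J ext_iso_add ext_iso_scale ext_iso_mult)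
qed (simp_all add: ext_iso_def omega_de perp_omega)

end

theorem theorem4p3:
  fixes scale :: "'k::field \<Rightarrow> 'v::ab_group_add \<Rightarrow> 'v"
    and Jt :: "'v set" and multt :: "'v \<Rightarrow> 'v \<Rightarrow> 'v"
    and \<alpha>t :: "'v \<Rightarrow> 'k" and \<omega>t :: "'v \<Rightarrow> 'v \<Rightarrow> 'k"
  assumes "CHAR('k) \<noteq> 2" and "CHAR('k) \<noteq> 3"
    and "cosymplectic_jj_algebra scale Jt multt \<alpha>t \<omega>t"
    and "Jt \<noteq> {0}"
    and "vector_space.dim scale Jt \<noteq> 1"
  shows "\<exists>(J :: 'v set) mult \<alpha> \<omega>.
    cosymplectic_jj_algebra scale J mult \<alpha> \<omega> \<and>
    cosymplectic_double_extension scale Jt multt \<alpha>t \<omega>t scale J mult \<alpha> \<omega>"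
proof -
  interpret cosymplectic_jj_algebra scale Jt multt \<alpha>t \<omega>t by (rule assms(3))
  have "\<not> p dvd 2" "\<not> p dvd 3" if "p \<noteq> 1" "p \<noteq> 2" "p \<noteq> 3" for p :: nat
  proof -
    have "p = 0 \<or> p > 3" using that by linarith
    then show "\<not> p dvd 2" "\<not> p dvd 3" by (auto dest: dvd_imp_le)
  qed
  from this[of "CHAR('k)"] have "\<not> CHAR('k) dvd 2" "\<not> CHAR('k) dvd 3"
    using assms(1,2) CHAR_not_1'[where ?'a = 'k] by simp_all
  then have ch: "(2::'k) \<noteq> 0" "(3::'k) \<noteq> 0"
    using of_nat_eq_0_iff_char_dvd[of 2, where ?'a = 'k] of_nat_eq_0_iff_char_dvd[of 3, where ?'a = 'k]
    by simp_all
  obtain e where e: "e \<in> Jt" "e \<noteq> 0" "\<alpha>t e = 0" "\<And>x. x \<in> Jt \<Longrightarrow> multt x e = 0"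
    using annihilated_kernel_vector[OF ch assms(5)] by blast
  obtain d where d: "d \<in> Jt" "\<omega>t d e = 1"
    using omega_nondegenerate_on_kernel[OF ch(1) e(1-3)] by blast
  interpret cosymplectic_reduction scale Jt multt \<alpha>t \<omega>t d e
    by unfold_locales (use ch assms(5) e d in auto)
  show ?thesis using cosymplectic_perp double_extension by blast
qed

end
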